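(* Let $\mathbf C$ be a crossed complex. For all $n\ge1$ the fibration $\eta_{n+1}:P_{n+1}(\mathbf C)\to P_n(\mathbf C)$ of the Postnikov tower of $\mathbf C$ provides a 2-extension of $P_n(\mathbf C)$ by the $\pi_1(\mathbf C)$-module $\pi_{n+1}(\mathbf C)$.
   Context: Groupoids are small. For a groupoid $G$, a $G$-group (resp. $G$-module) is a functor $G\to\mathbf{Gr}$ (resp. $\mathbf{Ab}$). $\widehat C$ is the totally disconnected groupoid with objects $\mathrm{obj}(G)$ and endomorphism groups $C(x)$. $\mathrm{End}_G$ is the $G$-group $x\mapsto G(x,x)$ with conjugation action. A crossed module is $(G,C,\delta)$ with $C$ a $G$-group, $\delta:C\to\mathrm{End}_G$ natural and ${}^{\delta_x(u)}v=uvu^{-1}$. Morphisms $(f,\alpha)$: a functor $f:G\to G'$ and natural $\alpha:C\to C'\circ f$ with $f(\delta_x(u))=\delta'_{f(x)}(\alpha_x(u))$; $\mathbf{Xm}_G$: crossed modules over $G$, $f=1_G$. $\mathbf 0_G=(G,0,0)$, $\mathbf 1_G=(G,\mathrm{End}_G,1)$. A $G$-crossed complex $\mathbf C$ is a sequence $\cdots\to\mathcal C_{n+1}\xrightarrow{\partial_{n+1}}\mathcal C_n\to\cdots\to\mathcal C_2\xrightarrow{\partial_2}\mathbf 1_G$ in $\mathbf{Xm}_G$, $\mathcal C_n=(G,C_n,\delta_n)$, with trivial consecutive composites on underlying $G$-groups (so $\delta_n=0$, $C_n$ a $G$-module for $n\ge3$) and such that $\mathrm{Im}\,\partial_2$ acts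 trivially on $C_n$ for $n\ge3$. It is an $n$-crossed complex if $\mathcal C_m=\mathbf 0_G$ for $m>n$ ($1$-crossed complexes are groupoids, $2$-crossed complexes are crossed modules). $\pi_1(\mathbf C)=G/\mathrm{Im}\,\partial_2$ with projection $q_1:G\to\pi_1(\mathbf C)$; for $n\ge2$, $\pi_n(\mathbf C)$ is the $\pi_1(\mathbf C)$-module $x\mapsto\ker(\partial_n)_x/\mathrm{Im}(\partial_{n+1})_x$, also regarded as a $G$-module via $q_1$. $P_1(\mathbf C)=\pi_1(\mathbf C)$ and for $n\ge2$, $P_n(\mathbf C)=(\mathcal C_n/\mathrm{Im}\,\partial_{n+1}\xrightarrow{\bar\partial_n}\mathcal C_{n-1}\to\cdots\to\mathcal C_2\to\mathbf 1_G)$, with $\bar\partial_n$ induced by $\partial_n$ and $q_n:C_n\to C_n/\mathrm{Im}\,\partial_{n+1}$ the quotient. The Postnikov tower of $\mathbf C$ is $\cdots\to P_{n+1}(\mathbf C)\xrightarrow{\eta_{n+1}}P_n(\mathbf C)\to\cdots$. For $n\ge2$, $\eta_{n+1}$ is the trivial map in dimension $n+1$, $q_n$ in dimension $n$ and the identity otherwise; $\eta_2$ has change of base $q_1$ and is trivial in dimension 2. 2-extension of a groupoid $\Pi$ by a $\Pi$-module $A$: a crossed module $(G,C,\delta)$ with an exact sequence $0\to\widehat A\to\widehat C\xrightarrow{\hat\delta}G\xrightarrow{q}\Pi\to0$ of groupoids with object set $\mathrm{obj}(\Pi)$ and functors that are the identity on objects, such that the kernel of $\delta$ is, as a $G$-module,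 $A\circ q$. 2-extension of a crossed module $\mathcal C=(G,C,\delta)$ by a $\pi_1(\mathcal C)$-module $A$ (with $q:G\to\pi_1(\mathcal C)=G/\mathrm{Im}\,\delta$): an exact sequence of $G$-groups $0\to A\circ q\to E_1\xrightarrow{\sigma}E_0\xrightarrow{\tau}C\to0$ such that $(G,E_1,0)\xrightarrow{\sigma}(G,E_0,\delta\tau)\xrightarrow{\delta\tau}\mathbf 1_G$ is a 3-crossed complex. 2-extension of an $n$-crossed complex $\mathbf C$, $n>2$, by a $\pi_1(\mathbf C)$-module $A$ (with $q:G\to\pi_1(\mathbf C)$ the projection): an exact sequence of $G$-groups $0\to A\circ q\to E_1\xrightarrow{\sigma}E_0\xrightarrow{\tau}C_n\to0$ such that $(G,E_1,0)\xrightarrow{\sigma}(G,E_0,0)\xrightarrow{\partial_n\tau}\mathcal C_{n-1}\to\cdots\to\mathcal C_2\xrightarrow{\partial_2}\mathbf 1_G$ is an $(n+1)$-crossed complex. *)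

theory Defs
  imports "HOL-Algebra.Coset" "HOL-Algebra.Elementary_Groups"
begin

section \<open>Groupoids\<close>

text \<open>\<open>Comp G g f\<close> is the composite \<open>g \<circ> f\<close>, meaningful when \<open>Dom G g = Cod G f\<close>.\<close>

record ('o, 'a) groupoid =
  Obj :: "'o set"
  Arr :: "'a set"
  Dom :: "'a \<Rightarrow> 'o"
  Cod :: "'a \<Rightarrow> 'o"
  Idn :: "'o \<Rightarrow> 'a"
  Comp :: "'a \<Rightarrow> 'a \<Rightarrow> 'a"

definition is_groupoid :: "('o, 'a) groupoid \<Rightarrow> bool" where
  "is_groupoid G \<longleftrightarrow>
     (\<forall>g\<in>Arr G. Dom G g \<in> Obj G \<and> Cod G g \<in> Obj G) \<and>
     (\<forall>x\<in>Obj G. Idn G x \<in> Arr G \<and> Dom G (Idn G x) = x \<and> Cod G (Idn G x) = x) \<and>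
     (\<forall>g\<in>Arr G. \<forall>f\<in>Arr G. Dom G g = Cod G f \<longrightarrow>
        Comp G g f \<in> Arr G \<and> Dom G (Comp G g f) = Dom G f \<and> Cod G (Comp G g f) = Cod G g) \<and>
     (\<forall>h\<in>Arr G. \<forall>g\<in>Arr G. \<forall>f\<in>Arr G. Dom G h = Cod G g \<longrightarrow> Dom G g = Cod G f \<longrightarrow>
        Comp G (Comp G h g) f = Comp G h (Comp G g f)) \<and>
     (\<forall>g\<in>Arr G. Comp G g (Idn G (Dom G g)) = g \<and> Comp G (Idn G (Cod G g)) g = g) \<and>
     (\<forall>g\<in>Arr G. \<exists>h\<in>Arr G. Dom G h = Cod G g \<and> Cod G h = Dom G g \<and>
        Comp G h g = Idn G (Dom G g) \<and> Comp G g h = Idn G (Cod G g))"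

definition ginv :: "('o, 'a) groupoid \<Rightarrow> 'a \<Rightarrow> 'a" where
  "ginv G g = (THE h. h \<in> Arr G \<and> Dom G h = Cod G g \<and> Cod G h = Dom G g \<and>
        Comp G h g = Idn G (Dom G g) \<and> Comp G g h = Idn G (Cod G g))"

definition is_functor ::
  "('o, 'a) groupoid \<Rightarrow> ('p, 'b) groupoid \<Rightarrow> ('o \<Rightarrow> 'p) \<Rightarrow> ('a \<Rightarrow> 'b) \<Rightarrow> bool" where
  "is_functor G H fo fa \<longleftrightarrow>
     (\<forall>x\<in>Obj G. fo x \<in> Obj H) \<and>
     (\<forall>g\<in>Arr G. fa g \<in> Arr H \<and> Dom H (fa g) = fo (Dom G g) \<and> Cod H (fa g) = fo (Cod G g)) \<and>
     (\<forall>x\<in>Obj G. fa (Idn G x) = Idn H (fo x)) \<and>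
     (\<forall>g\<in>Arr G. \<forall>f\<in>Arr G. Dom G g = Cod G f \<longrightarrow> fa (Comp G g f) = Comp H (fa g) (fa f))"

text \<open>The arrows sent to identities.\<close>

definition functor_kernel ::
  "('o, 'a) groupoid \<Rightarrow> ('p, 'b) groupoid \<Rightarrow> ('a \<Rightarrow> 'b) \<Rightarrow> 'a set" where
  "functor_kernel G H fa = {g \<in> Arr G. fa g \<in> Idn H ` Obj H}"

text \<open>
  The quotient \<open>G/N\<close> by a normal totally disconnected subgroupoid with vertex groups \<open>N x\<close>.
  Its objects are those of \<open>G\<close>; its arrows are the cosets \<open>g N\<close>. All members of a coset have
  the same domain and codomain, and the identity at \<open>x\<close> is the coset \<open>N x\<close> itself.
\<close>

definition gcoset :: "('o, 'a) groupoid \<Rightarrow> ('o \<Rightarrow> 'a set) \<Rightarrow> 'a \<Rightarrow> 'a set" where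
  "gcoset G N g = Comp G g ` N (Dom G g)"

definition quotient_groupoid ::
  "('o, 'a) groupoid \<Rightarrow> ('o \<Rightarrow> 'a set) \<Rightarrow> ('o, 'a set) groupoid" where
  "quotient_groupoid G N =
     \<lparr> Obj = Obj G,
       Arr = gcoset G N ` Arr G,
       Dom = (\<lambda>X. the_elem (Dom G ` X)),
       Cod = (\<lambda>X. the_elem (Cod G ` X)),
       Idn = N,
       Comp = (\<lambda>X Y. {Comp G g f | g f. g \<in> X \<and> f \<in> Y}) \<rparr>"


section \<open>\<open>G\<close>-groups and \<open>G\<close>-modules\<close>

text \<open>A functor from \<open>G\<close> to groups: \<open>act C g\<close> is the homomorphism induced by the arrow \<open>g\<close>.\<close>

record ('o, 'a, 'c) ggroup =
  grp :: "'o \<Rightarrow> 'c monoid"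
  act :: "'a \<Rightarrow> 'c \<Rightarrow> 'c"

definition is_ggroup :: "('o, 'a) groupoid \<Rightarrow> ('o, 'a, 'c, 'z) ggroup_scheme \<Rightarrow> bool" where
  "is_ggroup G C \<longleftrightarrow>
     (\<forall>x\<in>Obj G. group (grp C x)) \<and>
     (\<forall>g\<in>Arr G. act C g \<in> hom (grp C (Dom G g)) (grp C (Cod G g))) \<and>
     (\<forall>x\<in>Obj G. \<forall>u\<in>carrier (grp C x). act C (Idn G x) u = u) \<and>
     (\<forall>g\<in>Arr G. \<forall>f\<in>Arr G. Dom G g = Cod G f \<longrightarrow>
        (\<forall>u\<in>carrier (grp C (Dom G f)). act C (Comp G g f) u = act C g (act C f u)))"

definition is_gmodule :: "('o, 'a) groupoid \<Rightarrow> ('o, 'a, 'c, 'z) ggroup_scheme \<Rightarrow> bool" where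
  "is_gmodule G C \<longleftrightarrow> is_ggroup G C \<and> (\<forall>x\<in>Obj G. comm_group (grp C x))"

definition ggroup_hom ::
  "('o, 'a) groupoid \<Rightarrow> ('o, 'a, 'c, 'y) ggroup_scheme \<Rightarrow> ('o, 'a, 'd, 'z) ggroup_scheme
     \<Rightarrow> ('o \<Rightarrow> 'c \<Rightarrow> 'd) \<Rightarrow> bool" where
  "ggroup_hom G C D \<alpha> \<longleftrightarrow>
     (\<forall>x\<in>Obj G. \<alpha> x \<in> hom (grp C x) (grp D x)) \<and>
     (\<forall>g\<in>Arr G. \<forall>u\<in>carrier (grp C (Dom G g)).
        \<alpha> (Cod G g) (act C g u) = act D g (\<alpha> (Dom G g) u))"

text \<open>The composite \<open>C \<circ> f\<close> with a functor \<open>f = (fo, fa)\<close>.\<close>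

definition pullback ::
  "('o \<Rightarrow> 'p) \<Rightarrow> ('a \<Rightarrow> 'b) \<Rightarrow> ('p, 'b, 'c, 'z) ggroup_scheme \<Rightarrow> ('o, 'a, 'c) ggroup" where
  "pullback fo fa C = \<lparr> grp = (\<lambda>x. grp C (fo x)), act = (\<lambda>g. act C (fa g)) \<rparr>"

definition End_ggroup :: "('o, 'a) groupoid \<Rightarrow> ('o, 'a, 'a) ggroup" where
  "End_ggroup G =
     \<lparr> grp = (\<lambda>x. \<lparr> carrier = {g \<in> Arr G. Dom G g = x \<and> Cod G g = x},
                    mult = Comp G, one = Idn G x \<rparr>),
       act = (\<lambda>g u. Comp G (Comp G g u) (ginv G g)) \<rparr>"

text \<open>The totally disconnected groupoid \<open>\<hat>C\<close> with vertex groups \<open>C x\<close>.\<close>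

definition hat :: "'o set \<Rightarrow> ('o, 'a, 'c, 'z) ggroup_scheme \<Rightarrow> ('o, 'o \<times> 'c) groupoid" where
  "hat X C =
     \<lparr> Obj = X,
       Arr = (SIGMA x:X. carrier (grp C x)),
       Dom = fst,
       Cod = fst,
       Idn = (\<lambda>x. (x, \<one>\<^bsub>grp C x\<^esub>)),
       Comp = (\<lambda>p q. (fst p, snd p \<otimes>\<^bsub>grp C (fst p)\<^esub> snd q)) \<rparr>"

definition hat_map :: "('o \<Rightarrow> 'c \<Rightarrow> 'd) \<Rightarrow> 'o \<times> 'c \<Rightarrow> 'o \<times> 'd" where
  "hat_map \<alpha> p = (fst p, \<alpha> (fst p) (snd p))"

text \<open>Exactness of \<open>0 \<rightarrow> A \<rightarrow> E1 \<rightarrow> E0 \<rightarrow> C \<rightarrow> 0\<close>, with maps \<open>\<iota>\<close>, \<open>\<sigma>\<close>, \<open>\<tau>\<close>.\<close>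

definition exact_ggroups ::
  "('o, 'a) groupoid \<Rightarrow> ('o, 'a, 'm, 'v) ggroup_scheme \<Rightarrow> ('o \<Rightarrow> 'm \<Rightarrow> 'e)
     \<Rightarrow> ('o, 'a, 'e, 'w) ggroup_scheme \<Rightarrow> ('o \<Rightarrow> 'e \<Rightarrow> 'f)
     \<Rightarrow> ('o, 'a, 'f, 'y) ggroup_scheme \<Rightarrow> ('o \<Rightarrow> 'f \<Rightarrow> 'c)
     \<Rightarrow> ('o, 'a, 'c, 'z) ggroup_scheme \<Rightarrow> bool" where
  "exact_ggroups G A \<iota> E1 \<sigma> E0 \<tau> C \<longleftrightarrow>
     is_ggroup G A \<and> is_ggroup G E1 \<and> is_ggroup G E0 \<and> is_ggroup G C \<and>
     ggroup_hom G A E1 \<iota> \<and> ggroup_hom G E1 E0 \<sigma> \<and> ggroup_hom G E0 C \<tau> \<and>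
     (\<forall>x\<in>Obj G.
        inj_on (\<iota> x) (carrier (grp A x)) \<and>
        \<iota> x ` carrier (grp A x) = kernel (grp E1 x) (grp E0 x) (\<sigma> x) \<and>
        \<sigma> x ` carrier (grp E1 x) = kernel (grp E0 x) (grp C x) (\<tau> x) \<and>
        \<tau> x ` carrier (grp E0 x) = carrier (grp C x))"


section \<open>Crossed modules\<close>

text \<open>
  A crossed module \<open>(G, C, \<delta>)\<close> is a record \<open>M\<close> carrying \<open>C\<close> and \<open>\<delta>\<close>; the base groupoid \<open>G\<close> is
  a separate argument.
\<close>

record ('o, 'a, 'c) xmod = "('o, 'a, 'c) ggroup" +
  del :: "'o \<Rightarrow> 'c \<Rightarrow> 'a"

definition xm :: "('o, 'a, 'c, 'z) ggroup_scheme \<Rightarrow> ('o \<Rightarrow> 'c \<Rightarrow> 'a) \<Rightarrow> ('o, 'a, 'c) xmod" where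
  "xm C d = \<lparr> grp = grp C, act = act C, del = d \<rparr>"

definition crossed_module :: "('o, 'a) groupoid \<Rightarrow> ('o, 'a, 'c) xmod \<Rightarrow> bool" where
  "crossed_module G M \<longleftrightarrow>
     is_groupoid G \<and> is_ggroup G M \<and> ggroup_hom G M (End_ggroup G) (del M) \<and>
     (\<forall>x\<in>Obj G. \<forall>u\<in>carrier (grp M x). \<forall>v\<in>carrier (grp M x).
        act M (del M x u) v = u \<otimes>\<^bsub>grp M x\<^esub> v \<otimes>\<^bsub>grp M x\<^esub> inv\<^bsub>grp M x\<^esub> u)"

definition xmod_hom ::
  "('o, 'a) groupoid \<Rightarrow> ('o, 'a, 'c) xmod \<Rightarrow> ('p, 'b) groupoid \<Rightarrow> ('p, 'b, 'd) xmod
     \<Rightarrow> ('o \<Rightarrow> 'p) \<Rightarrow> ('a \<Rightarrow> 'b) \<Rightarrow> ('o \<Rightarrow> 'c \<Rightarrow> 'd) \<Rightarrow> bool" where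
  "xmod_hom G M G' M' fo fa \<alpha> \<longleftrightarrow>
     is_functor G G' fo fa \<and> ggroup_hom G M (pullback fo fa M') \<alpha> \<and>
     (\<forall>x\<in>Obj G. \<forall>u\<in>carrier (grp M x). fa (del M x u) = del M' (fo x) (\<alpha> x u))"

abbreviation xmod_hom_over ::
  "('o, 'a) groupoid \<Rightarrow> ('o, 'a, 'c) xmod \<Rightarrow> ('o, 'a, 'd) xmod \<Rightarrow> ('o \<Rightarrow> 'c \<Rightarrow> 'd) \<Rightarrow> bool" where
  "xmod_hom_over G M M' \<alpha> \<equiv> xmod_hom G M G M' (\<lambda>x. x) (\<lambda>g. g) \<alpha>"

definition zero_xmod :: "('o, 'a) groupoid \<Rightarrow> ('o, 'a, 'c) xmod" where
  "zero_xmod G =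
     \<lparr> grp = (\<lambda>x. singleton_group undefined), act = (\<lambda>g u. undefined), del = (\<lambda>x u. Idn G x) \<rparr>"

definition one_xmod :: "('o, 'a) groupoid \<Rightarrow> ('o, 'a, 'a) xmod" where
  "one_xmod G = xm (End_ggroup G) (\<lambda>x u. u)"

text \<open>Being the zero crossed module, up to the name of the only element of each group.\<close>

definition is_zero_xmod :: "('o, 'a) groupoid \<Rightarrow> ('o, 'a, 'c) xmod \<Rightarrow> bool" where
  "is_zero_xmod G M \<longleftrightarrow> crossed_module G M \<and> (\<forall>x\<in>Obj G. carrier (grp M x) = {\<one>\<^bsub>grp M x\<^esub>})"

definition xmod_image :: "('o, 'a, 'c) xmod \<Rightarrow> 'o \<Rightarrow> 'a set" where
  "xmod_image M x = del M x ` carrier (grp M x)"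

definition xmod_pi1 :: "('o, 'a) groupoid \<Rightarrow> ('o, 'a, 'c) xmod \<Rightarrow> ('o, 'a set) groupoid" where
  "xmod_pi1 G M = quotient_groupoid G (xmod_image M)"

definition xmod_q1 :: "('o, 'a) groupoid \<Rightarrow> ('o, 'a, 'c) xmod \<Rightarrow> 'a \<Rightarrow> 'a set" where
  "xmod_q1 G M = gcoset G (xmod_image M)"

text \<open>
  The quotient of \<open>M\<close> by normal subgroups \<open>N x\<close> stable under the action and killed by \<open>\<delta>\<close>. An
  arrow moves a coset by taking its image, and \<open>\<delta>\<close> is constant on each coset.
\<close>

definition quotient_xmod :: "('o, 'a, 'c) xmod \<Rightarrow> ('o \<Rightarrow> 'c set) \<Rightarrow> ('o, 'a, 'c set) xmod" where
  "quotient_xmod M N =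
     \<lparr> grp = (\<lambda>x. grp M x Mod N x),
       act = (\<lambda>g X. act M g ` X),
       del = (\<lambda>x X. the_elem (del M x ` X)) \<rparr>"


section \<open>Crossed complexes\<close>

text \<open>
  \<open>cterm K n\<close> (\<open>n \<ge> 2\<close>) is the crossed module \<open>(G, C\<^sub>n, \<delta>\<^sub>n)\<close>, \<open>bd2 K\<close> is the boundary from
  dimension 2 to \<open>End\<^sub>G\<close>, and \<open>bd K n\<close> (\<open>n \<ge> 3\<close>) is the boundary from dimension \<open>n\<close> to dimension
  \<open>n - 1\<close>. Values at other indices are irrelevant.
\<close>

record ('o, 'a, 'c) xcomplex =
  base :: "('o, 'a) groupoid"
  cterm :: "nat \<Rightarrow> ('o, 'a, 'c) xmod"
  bd2 :: "'o \<Rightarrow> 'c \<Rightarrow> 'a"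
  bd :: "nat \<Rightarrow> 'o \<Rightarrow> 'c \<Rightarrow> 'c"

abbreviation cgrp :: "('o, 'a, 'c) xcomplex \<Rightarrow> nat \<Rightarrow> 'o \<Rightarrow> 'c monoid" where
  "cgrp K n x \<equiv> grp (cterm K n) x"

definition crossed_complex :: "('o, 'a, 'c) xcomplex \<Rightarrow> bool" where
  "crossed_complex K \<longleftrightarrow>
     is_groupoid (base K) \<and>
     (\<forall>n\<ge>2. crossed_module (base K) (cterm K n)) \<and>
     xmod_hom_over (base K) (cterm K 2) (one_xmod (base K)) (bd2 K) \<and>
     (\<forall>n\<ge>3. xmod_hom_over (base K) (cterm K n) (cterm K (n - 1)) (bd K n)) \<and>
     (\<forall>x\<in>Obj (base K). \<forall>u\<in>carrier (cgrp K 3 x). bd2 K x (bd K 3 x u) = Idn (base K) x) \<and>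
     (\<forall>n\<ge>3. \<forall>x\<in>Obj (base K). \<forall>u\<in>carrier (cgrp K (n + 1) x).
        bd K n x (bd K (n + 1) x u) = \<one>\<^bsub>cgrp K (n - 1) x\<^esub>) \<and>
     (\<forall>n\<ge>3. \<forall>x\<in>Obj (base K). \<forall>w\<in>carrier (cgrp K 2 x). \<forall>u\<in>carrier (cgrp K n x).
        act (cterm K n) (bd2 K x w) u = u)"

definition n_crossed_complex :: "nat \<Rightarrow> ('o, 'a, 'c) xcomplex \<Rightarrow> bool" where
  "n_crossed_complex n K \<longleftrightarrow>
     crossed_complex K \<and> (\<forall>m\<ge>2. m > n \<longrightarrow> is_zero_xmod (base K) (cterm K m))"

text \<open>A morphism: a functor \<open>(fo, fa)\<close> on the bases and \<open>\<alpha> n\<close> in each dimension \<open>n \<ge> 2\<close>.\<close>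

definition xcomplex_hom ::
  "('o, 'a, 'c) xcomplex \<Rightarrow> ('p, 'b, 'd) xcomplex
     \<Rightarrow> ('o \<Rightarrow> 'p) \<Rightarrow> ('a \<Rightarrow> 'b) \<Rightarrow> (nat \<Rightarrow> 'o \<Rightarrow> 'c \<Rightarrow> 'd) \<Rightarrow> bool" where
  "xcomplex_hom K L fo fa \<alpha> \<longleftrightarrow>
     crossed_complex K \<and> crossed_complex L \<and> is_functor (base K) (base L) fo fa \<and>
     (\<forall>n\<ge>2. xmod_hom (base K) (cterm K n) (base L) (cterm L n) fo fa (\<alpha> n)) \<and>
     (\<forall>x\<in>Obj (base K). \<forall>u\<in>carrier (cgrp K 2 x).
        fa (bd2 K x u) = bd2 L (fo x) (\<alpha> 2 x u)) \<and>
     (\<forall>n\<ge>3. \<forall>x\<in>Obj (base K). \<forall>u\<in>carrier (cgrp K n x).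
        \<alpha> (n - 1) x (bd K n x u) = bd L n (fo x) (\<alpha> n x u))"

text \<open>
  Fibrations in the sense of Brown and Golasinski: the functor on bases is a fibration of groupoids
  and the components in dimensions \<open>n \<ge> 2\<close> are surjective.
\<close>

definition xcomplex_fibration ::
  "('o, 'a, 'c) xcomplex \<Rightarrow> ('p, 'b, 'd) xcomplex
     \<Rightarrow> ('o \<Rightarrow> 'p) \<Rightarrow> ('a \<Rightarrow> 'b) \<Rightarrow> (nat \<Rightarrow> 'o \<Rightarrow> 'c \<Rightarrow> 'd) \<Rightarrow> bool" where
  "xcomplex_fibration K L fo fa \<alpha> \<longleftrightarrow>
     xcomplex_hom K L fo fa \<alpha> \<and>
     (\<forall>x\<in>Obj (base K). \<forall>h\<in>Arr (base L). Dom (base L) h = fo x \<longrightarrow>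
        (\<exists>g\<in>Arr (base K). Dom (base K) g = x \<and> fa g = h)) \<and>
     (\<forall>n\<ge>2. \<forall>x\<in>Obj (base K).
        \<alpha> n x ` carrier (cgrp K n x) = carrier (cgrp L n (fo x)))"

text \<open>A groupoid as a crossed complex that vanishes in dimensions \<open>\<ge> 2\<close>.\<close>

definition groupoid_xcomplex :: "('o, 'a) groupoid \<Rightarrow> ('o, 'a, 'c) xcomplex" where
  "groupoid_xcomplex G =
     \<lparr> base = G,
       cterm = (\<lambda>n. zero_xmod G),
       bd2 = (\<lambda>x u. Idn G x),
       bd = (\<lambda>n x u. \<one>\<^bsub>grp (zero_xmod G) x\<^esub>) \<rparr>"


section \<open>Homotopy modules and the Postnikov tower\<close>

definition im2 :: "('o, 'a, 'c) xcomplex \<Rightarrow> 'o \<Rightarrow> 'a set" where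
  "im2 K x = bd2 K x ` carrier (cgrp K 2 x)"

text \<open>\<open>cker K n x\<close> is \<open>ker (\<partial>\<^sub>n)\<^sub>x\<close> and \<open>cim K n x\<close> is \<open>Im (\<partial>\<^sub>n\<^sub>+\<^sub>1)\<^sub>x\<close>; both lie in \<open>C\<^sub>n x\<close>.\<close>

definition cker :: "('o, 'a, 'c) xcomplex \<Rightarrow> nat \<Rightarrow> 'o \<Rightarrow> 'c set" where
  "cker K n x =
     (if n = 2 then kernel (cgrp K 2 x) (grp (End_ggroup (base K)) x) (bd2 K x)
      else kernel (cgrp K n x) (cgrp K (n - 1) x) (bd K n x))"

definition cim :: "('o, 'a, 'c) xcomplex \<Rightarrow> nat \<Rightarrow> 'o \<Rightarrow> 'c set" where
  "cim K n x = bd K (n + 1) x ` carrier (cgrp K (n + 1) x)"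

definition pi1 :: "('o, 'a, 'c) xcomplex \<Rightarrow> ('o, 'a set) groupoid" where
  "pi1 K = quotient_groupoid (base K) (im2 K)"

definition q1 :: "('o, 'a, 'c) xcomplex \<Rightarrow> 'a \<Rightarrow> 'a set" where
  "q1 K = gcoset (base K) (im2 K)"

text \<open>
  The \<open>\<pi>\<^sub>1\<close>-module \<open>\<pi>\<^sub>n\<close> for \<open>n \<ge> 2\<close>. The class of \<open>g\<close> sends the class of \<open>u\<close> to the class of
  \<open>g \<cdot> u\<close>, which is the set of all \<open>g' \<cdot> u'\<close> with \<open>g'\<close> and \<open>u'\<close> in the respective classes.
\<close>

definition homotopy_module ::
  "('o, 'a, 'c) xcomplex \<Rightarrow> nat \<Rightarrow> ('o, 'a set, 'c set) ggroup" where
  "homotopy_module K n =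
     \<lparr> grp = (\<lambda>x. (cgrp K n x)\<lparr>carrier := cker K n x\<rparr> Mod cim K n x),
       act = (\<lambda>X U. {act (cterm K n) g u | g u. g \<in> X \<and> u \<in> U}) \<rparr>"

text \<open>The quotient map \<open>q\<^sub>n : C\<^sub>n \<rightarrow> C\<^sub>n / Im \<partial>\<^sub>n\<^sub>+\<^sub>1\<close>.\<close>

definition qmap :: "('o, 'a, 'c) xcomplex \<Rightarrow> nat \<Rightarrow> 'o \<Rightarrow> 'c \<Rightarrow> 'c set" where
  "qmap K n x u = cim K n x #>\<^bsub>cgrp K n x\<^esub> u"

text \<open>
  \<open>P\<^sub>n\<close> for \<open>n \<ge> 2\<close>. The elements of \<open>C\<^sub>n / Im \<partial>\<^sub>n\<^sub>+\<^sub>1\<close> are sets of elements of \<open>C\<^sub>n\<close>, and all terms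
  of a crossed complex have elements of one type. The lower terms \<open>C\<^sub>m\<close> (\<open>m < n\<close>) are therefore
  written as \<open>C\<^sub>m / {1}\<close>, which is \<open>C\<^sub>m\<close> with each element \<open>u\<close> renamed to the singleton \<open>{u}\<close>.
  Since \<open>\<partial>\<^sub>n\<close> is constant on the cosets of \<open>Im \<partial>\<^sub>n\<^sub>+\<^sub>1\<close>, taking images induces both the
  renamed \<open>\<partial>\<^sub>m\<close> for \<open>m < n\<close> and the map from \<open>C\<^sub>n / Im \<partial>\<^sub>n\<^sub>+\<^sub>1\<close>.
\<close>

definition postnikov_term ::
  "('o, 'a, 'c) xcomplex \<Rightarrow> nat \<Rightarrow> nat \<Rightarrow> ('o, 'a, 'c set) xmod" where
  "postnikov_term K n m =
     (if m < n then quotient_xmod (cterm K m) (\<lambda>x. {\<one>\<^bsub>cgrp K m x\<^esub>})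
      else if m = n then quotient_xmod (cterm K n) (cim K n)
      else zero_xmod (base K))"

definition postnikov :: "('o, 'a, 'c) xcomplex \<Rightarrow> nat \<Rightarrow> ('o, 'a, 'c set) xcomplex" where
  "postnikov K n =
     \<lparr> base = base K,
       cterm = postnikov_term K n,
       bd2 = (\<lambda>x X. the_elem (bd2 K x ` X)),
       bd = (\<lambda>m x X. if m \<le> n then bd K m x ` X
                     else \<one>\<^bsub>grp (postnikov_term K n (m - 1)) x\<^esub>) \<rparr>"

definition postnikov1 :: "('o, 'a, 'c) xcomplex \<Rightarrow> ('o, 'a set, 'c set) xcomplex" where
  "postnikov1 K = groupoid_xcomplex (pi1 K)"

text \<open>
  The components in dimensions \<open>m \<ge> 2\<close> of \<open>\<eta>\<^sub>k : P\<^sub>k \<rightarrow> P\<^sub>k\<^sub>-\<^sub>1\<close> for \<open>k \<ge> 2\<close>; on bases \<open>\<eta>\<^sub>2\<close> is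
  \<open>q\<^sub>1\<close> and \<open>\<eta>\<^sub>k\<close> is the identity for \<open>k \<ge> 3\<close>. In dimension \<open>k - 1\<close> the source is \<open>C\<^sub>k\<^sub>-\<^sub>1\<close> in
  its renamed form, so its elements are singletons.
\<close>

definition eta :: "('o, 'a, 'c) xcomplex \<Rightarrow> nat \<Rightarrow> nat \<Rightarrow> 'o \<Rightarrow> 'c set \<Rightarrow> 'c set" where
  "eta K k m =
     (if m = k then (\<lambda>x X. \<one>\<^bsub>grp (zero_xmod (base K)) x\<^esub>)
      else if m = k - 1 then (\<lambda>x X. qmap K (k - 1) x (the_elem X))
      else (\<lambda>x X. X))"


section \<open>2-extensions\<close>

text \<open>
  In each case the data consist of the exact sequence with its maps, in particular the
  monomorphism \<open>\<iota>\<close> that identifies \<open>A \<circ> q\<close> with the kernel.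
\<close>

definition two_extension_groupoid ::
  "('o, 'b) groupoid \<Rightarrow> ('o, 'b, 'm, 'z) ggroup_scheme \<Rightarrow> ('o \<Rightarrow> 'm \<Rightarrow> 'c)
     \<Rightarrow> ('o, 'a) groupoid \<Rightarrow> ('o, 'a, 'c) xmod \<Rightarrow> ('a \<Rightarrow> 'b) \<Rightarrow> bool" where
  "two_extension_groupoid Q A \<iota> G M q \<longleftrightarrow>
     is_groupoid Q \<and> is_gmodule Q A \<and> crossed_module G M \<and> Obj G = Obj Q \<and>
     is_functor (hat (Obj Q) A) (hat (Obj G) M) (\<lambda>x. x) (hat_map \<iota>) \<and>
     is_functor (hat (Obj G) M) G (\<lambda>x. x) (\<lambda>p. del M (fst p) (snd p)) \<and>
     is_functor G Q (\<lambda>x. x) q \<and>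
     inj_on (hat_map \<iota>) (Arr (hat (Obj Q) A)) \<and>
     hat_map \<iota> ` Arr (hat (Obj Q) A) =
       functor_kernel (hat (Obj G) M) G (\<lambda>p. del M (fst p) (snd p)) \<and>
     (\<lambda>p. del M (fst p) (snd p)) ` Arr (hat (Obj G) M) = functor_kernel G Q q \<and>
     q ` Arr G = Arr Q \<and>
     ggroup_hom G (pullback (\<lambda>x. x) q A) M \<iota>"

text \<open>
  The complex \<open>(G, E1, 0) \<rightarrow> (G, E0, \<delta> \<tau>) \<rightarrow> 1\<^sub>G\<close> with maps \<open>\<sigma>\<close> and \<open>\<delta> \<tau>\<close>, zero above
  dimension 3.
\<close>

definition ext_xmod_term ::
  "('o, 'a) groupoid \<Rightarrow> ('o, 'a, 'c) xmod \<Rightarrow> ('o, 'a, 'e, 'w) ggroup_scheme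
     \<Rightarrow> ('o, 'a, 'e, 'y) ggroup_scheme \<Rightarrow> ('o \<Rightarrow> 'e \<Rightarrow> 'c) \<Rightarrow> nat \<Rightarrow> ('o, 'a, 'e) xmod" where
  "ext_xmod_term G M E1 E0 \<tau> m =
     (if m = 2 then xm E0 (\<lambda>x u. del M x (\<tau> x u))
      else if m = 3 then xm E1 (\<lambda>x u. Idn G x)
      else zero_xmod G)"

definition ext_xmod_complex ::
  "('o, 'a) groupoid \<Rightarrow> ('o, 'a, 'c) xmod \<Rightarrow> ('o, 'a, 'e, 'w) ggroup_scheme
     \<Rightarrow> ('o \<Rightarrow> 'e \<Rightarrow> 'e) \<Rightarrow> ('o, 'a, 'e, 'y) ggroup_scheme \<Rightarrow> ('o \<Rightarrow> 'e \<Rightarrow> 'c)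
     \<Rightarrow> ('o, 'a, 'e) xcomplex" where
  "ext_xmod_complex G M E1 \<sigma> E0 \<tau> =
     \<lparr> base = G,
       cterm = ext_xmod_term G M E1 E0 \<tau>,
       bd2 = (\<lambda>x u. del M x (\<tau> x u)),
       bd = (\<lambda>m x u. if m = 3 then \<sigma> x u
                     else \<one>\<^bsub>grp (ext_xmod_term G M E1 E0 \<tau> (m - 1)) x\<^esub>) \<rparr>"

definition two_extension_xmod ::
  "('o, 'a) groupoid \<Rightarrow> ('o, 'a, 'c) xmod \<Rightarrow> ('o, 'a set, 'm, 'z) ggroup_scheme
     \<Rightarrow> ('o \<Rightarrow> 'm \<Rightarrow> 'e) \<Rightarrow> ('o, 'a, 'e, 'w) ggroup_scheme \<Rightarrow> ('o \<Rightarrow> 'e \<Rightarrow> 'e)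
     \<Rightarrow> ('o, 'a, 'e, 'y) ggroup_scheme \<Rightarrow> ('o \<Rightarrow> 'e \<Rightarrow> 'c) \<Rightarrow> bool" where
  "two_extension_xmod G M A \<iota> E1 \<sigma> E0 \<tau> \<longleftrightarrow>
     crossed_module G M \<and> is_gmodule (xmod_pi1 G M) A \<and>
     exact_ggroups G (pullback (\<lambda>x. x) (xmod_q1 G M) A) \<iota> E1 \<sigma> E0 \<tau> M \<and>
     n_crossed_complex 3 (ext_xmod_complex G M E1 \<sigma> E0 \<tau>)"

text \<open>
  The complex \<open>(G, E1, 0) \<rightarrow> (G, E0, 0) \<rightarrow> C\<^sub>n\<^sub>-\<^sub>1 \<rightarrow> \<dots> \<rightarrow> C\<^sub>2 \<rightarrow> 1\<^sub>G\<close>, \<open>n > 2\<close>, with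
  \<open>\<sigma>\<close>, \<open>\<partial>\<^sub>n \<tau>\<close> and then the boundaries of \<open>K\<close>, zero above dimension \<open>n + 1\<close>.
\<close>

definition ext_xcomplex_term ::
  "nat \<Rightarrow> ('o, 'a, 'c) xcomplex \<Rightarrow> ('o, 'a, 'c, 'w) ggroup_scheme
     \<Rightarrow> ('o, 'a, 'c, 'y) ggroup_scheme \<Rightarrow> nat \<Rightarrow> ('o, 'a, 'c) xmod" where
  "ext_xcomplex_term n K E1 E0 m =
     (if m < n then cterm K m
      else if m = n then xm E0 (\<lambda>x u. Idn (base K) x)
      else if m = n + 1 then xm E1 (\<lambda>x u. Idn (base K) x)
      else zero_xmod (base K))"

definition ext_xcomplex ::
  "nat \<Rightarrow> ('o, 'a, 'c) xcomplex \<Rightarrow> ('o, 'a, 'c, 'w) ggroup_scheme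
     \<Rightarrow> ('o \<Rightarrow> 'c \<Rightarrow> 'c) \<Rightarrow> ('o, 'a, 'c, 'y) ggroup_scheme \<Rightarrow> ('o \<Rightarrow> 'c \<Rightarrow> 'c)
     \<Rightarrow> ('o, 'a, 'c) xcomplex" where
  "ext_xcomplex n K E1 \<sigma> E0 \<tau> =
     \<lparr> base = base K,
       cterm = ext_xcomplex_term n K E1 E0,
       bd2 = bd2 K,
       bd = (\<lambda>m x u. if m < n then bd K m x u
                     else if m = n then bd K n x (\<tau> x u)
                     else if m = n + 1 then \<sigma> x u
                     else \<one>\<^bsub>grp (ext_xcomplex_term n K E1 E0 (m - 1)) x\<^esub>) \<rparr>"

definition two_extension_xcomplex ::
  "nat \<Rightarrow> ('o, 'a, 'c) xcomplex \<Rightarrow> ('o, 'a set, 'm, 'z) ggroup_scheme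
     \<Rightarrow> ('o \<Rightarrow> 'm \<Rightarrow> 'c) \<Rightarrow> ('o, 'a, 'c, 'w) ggroup_scheme \<Rightarrow> ('o \<Rightarrow> 'c \<Rightarrow> 'c)
     \<Rightarrow> ('o, 'a, 'c, 'y) ggroup_scheme \<Rightarrow> ('o \<Rightarrow> 'c \<Rightarrow> 'c) \<Rightarrow> bool" where
  "two_extension_xcomplex n K A \<iota> E1 \<sigma> E0 \<tau> \<longleftrightarrow>
     n > 2 \<and> n_crossed_complex n K \<and> is_gmodule (pi1 K) A \<and>
     exact_ggroups (base K) (pullback (\<lambda>x. x) (q1 K) A) \<iota> E1 \<sigma> E0 \<tau> (cterm K n) \<and>
     n_crossed_complex (n + 1) (ext_xcomplex n K E1 \<sigma> E0 \<tau>)"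

end

theory Submission
  imports Defs
begin

text \<open>
  Fix a crossed complex with terms \<open>C\<^sub>m\<close> and boundaries \<open>\<partial>\<^sub>m\<close> over \<open>G\<close>. Passing from \<open>P\<^sub>n\<^sub>+\<^sub>1\<close> to
  \<open>P\<^sub>n\<close> discards \<open>C\<^sub>n\<^sub>+\<^sub>1 / Im \<partial>\<^sub>n\<^sub>+\<^sub>2\<close> and divides \<open>C\<^sub>n\<close> by \<open>Im \<partial>\<^sub>n\<^sub>+\<^sub>1\<close>. For \<open>n \<ge> 2\<close>, what is lost is
  described by the sequence
  \<open>0 \<rightarrow> \<pi>\<^sub>n\<^sub>+\<^sub>1 \<rightarrow> C\<^sub>n\<^sub>+\<^sub>1 / Im \<partial>\<^sub>n\<^sub>+\<^sub>2 \<rightarrow> C\<^sub>n \<rightarrow> C\<^sub>n / Im \<partial>\<^sub>n\<^sub>+\<^sub>1 \<rightarrow> 0\<close>, exact because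
  \<open>\<pi>\<^sub>n\<^sub>+\<^sub>1 = ker \<partial>\<^sub>n\<^sub>+\<^sub>1 / Im \<partial>\<^sub>n\<^sub>+\<^sub>2\<close> (\<open>postnikov_exact\<close>), and splicing it into \<open>P\<^sub>n\<close> gives
  \<open>P\<^sub>n\<^sub>+\<^sub>1\<close>, which is an \<open>(n + 1)\<close>-crossed complex (\<open>n_crossed_complex_postnikov\<close>). For \<open>n = 1\<close> the
  sequence is \<open>0 \<rightarrow> \<pi>\<^sub>2 \<rightarrow> C\<^sub>2 / Im \<partial>\<^sub>3 \<rightarrow> G \<rightarrow> \<pi>\<^sub>1 \<rightarrow> 0\<close>, now of groupoids.

  The work lies in the structure that these quotients carry, and it rests on two facts.

  The first is the Peiffer identity: since \<open>u v u\<^sup>-\<^sup>1\<close> is the action of \<open>\<delta> u\<close> on \<open>v\<close>, the kernel of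
  \<open>\<delta>\<close> is central (\<open>ker_del_central\<close>). Hence any subgroups that are stable under the action and killed
  by \<open>\<delta>\<close> are normal, and the quotient is again a crossed module (\<open>crossed_module_QM\<close>). All
  terms of \<open>P\<^sub>n\<close> up to dimension \<open>n\<close> are such quotients, by \<open>Im \<partial>\<^sub>n\<^sub>+\<^sub>1\<close> in dimension \<open>n\<close> and by the
  trivial subgroup below, and all the maps between them, boundaries as well as components of \<open>\<eta>\<close>, are
  induced by morphisms before passage to the quotient (\<open>quotient_xmod_hom\<close>).

  The second is that \<open>Im \<partial>\<^sub>2\<close> acts trivially on cycles (\<open>act_im2_cker\<close>): in dimension 2 because
  2-cycles are central, and above by the definition of a crossed complex. Therefore the action of \<open>G\<close>
  on \<open>\<pi>\<^sub>n\<close> factors through \<open>\<pi>\<^sub>1\<close> (\<open>is_gmodule_homotopy_module\<close>).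
\<close>

section \<open>Quotient groupoids\<close>

locale small_groupoid =
  fixes G :: "('o, 'a) groupoid"
  assumes groupoid: "is_groupoid G"
begin

lemma Dom_Obj [simp]: "g \<in> Arr G \<Longrightarrow> Dom G g \<in> Obj G"
  and Cod_Obj [simp]: "g \<in> Arr G \<Longrightarrow> Cod G g \<in> Obj G"
  using groupoid by (auto simp: is_groupoid_def)

lemma Idn_Arr [simp]: "x \<in> Obj G \<Longrightarrow> Idn G x \<in> Arr G"
  and Dom_Idn [simp]: "x \<in> Obj G \<Longrightarrow> Dom G (Idn G x) = x"
  and Cod_Idn [simp]: "x \<in> Obj G \<Longrightarrow> Cod G (Idn G x) = x"
  using groupoid by (auto simp: is_groupoid_def)

lemma Comp_Arr [simp]: "\<lbrakk>g \<in> Arr G; f \<in> Arr G; Dom G g = Cod G f\<rbrakk> \<Longrightarrow> Comp G g f \<in> Arr G"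
  and Dom_Comp [simp]: "\<lbrakk>g \<in> Arr G; f \<in> Arr G; Dom G g = Cod G f\<rbrakk> \<Longrightarrow> Dom G (Comp G g f) = Dom G f"
  and Cod_Comp [simp]: "\<lbrakk>g \<in> Arr G; f \<in> Arr G; Dom G g = Cod G f\<rbrakk> \<Longrightarrow> Cod G (Comp G g f) = Cod G g"
  using groupoid by (auto simp: is_groupoid_def)

lemma Comp_assoc:
  "\<lbrakk>h \<in> Arr G; g \<in> Arr G; f \<in> Arr G; Dom G h = Cod G g; Dom G g = Cod G f\<rbrakk>
     \<Longrightarrow> Comp G (Comp G h g) f = Comp G h (Comp G g f)"
  using groupoid unfolding is_groupoid_def by blast

lemma Comp_Idn_right [simp]: "\<lbrakk>g \<in> Arr G; Dom G g = x\<rbrakk> \<Longrightarrow> Comp G g (Idn G x) = g"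
  and Comp_Idn_left [simp]: "\<lbrakk>g \<in> Arr G; Cod G g = x\<rbrakk> \<Longrightarrow> Comp G (Idn G x) g = g"
  using groupoid by (auto simp: is_groupoid_def)

lemma left_inverse_unique:
  assumes "g \<in> Arr G" "h \<in> Arr G" "k \<in> Arr G"
    and "Cod G h = Dom G g" "Dom G k = Cod G g" "Dom G h = Cod G g"
    and "Comp G g h = Idn G (Cod G g)" "Comp G k g = Idn G (Dom G g)"
  shows "k = h"
  using assms Comp_assoc[of k g h] by simp

lemma ginv_spec:
  assumes "g \<in> Arr G"
  shows "ginv G g \<in> Arr G \<and> Dom G (ginv G g) = Cod G g \<and> Cod G (ginv G g) = Dom G g \<and>
    Comp G (ginv G g) g = Idn G (Dom G g) \<and> Comp G g (ginv G g) = Idn G (Cod G g)"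
proof -
  obtain h where h: "h \<in> Arr G \<and> Dom G h = Cod G g \<and> Cod G h = Dom G g \<and>
      Comp G h g = Idn G (Dom G g) \<and> Comp G g h = Idn G (Cod G g)"
    using groupoid assms by (auto simp: is_groupoid_def)
  show ?thesis
    unfolding ginv_def
  proof (rule theI)
    show "k = h" if "k \<in> Arr G \<and> Dom G k = Cod G g \<and> Cod G k = Dom G g \<and>
      Comp G k g = Idn G (Dom G g) \<and> Comp G g k = Idn G (Cod G g)" for k
      using left_inverse_unique[of g h k] h that assms by simp
  qed (rule h)
qed

lemma ginv_Arr [simp]: "g \<in> Arr G \<Longrightarrow> ginv G g \<in> Arr G"
  and Dom_ginv [simp]: "g \<in> Arr G \<Longrightarrow> Dom G (ginv G g) = Cod G g"
  and Cod_ginv [simp]: "g \<in> Arr G \<Longrightarrow> Cod G (ginv G g) = Dom G g"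
  and ginv_left [simp]: "g \<in> Arr G \<Longrightarrow> Comp G (ginv G g) g = Idn G (Dom G g)"
  and ginv_right [simp]: "g \<in> Arr G \<Longrightarrow> Comp G g (ginv G g) = Idn G (Cod G g)"
  using ginv_spec by blast+

lemma ginv_ginv [simp]: "g \<in> Arr G \<Longrightarrow> ginv G (ginv G g) = g"
  by (rule left_inverse_unique[of "ginv G g"]) auto

lemma End_simps:
  "carrier (grp (End_ggroup G) x) = {g \<in> Arr G. Dom G g = x \<and> Cod G g = x}"
  "mult (grp (End_ggroup G) x) = Comp G"
  "one (grp (End_ggroup G) x) = Idn G x"
  "act (End_ggroup G) g u = Comp G (Comp G g u) (ginv G g)"
  by (simp_all add: End_ggroup_def)

lemma group_End: "x \<in> Obj G \<Longrightarrow> group (grp (End_ggroup G) x)"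
proof (rule groupI)
  fix g assume "g \<in> carrier (grp (End_ggroup G) x)"
  then show "\<exists>h\<in>carrier (grp (End_ggroup G) x). h \<otimes>\<^bsub>grp (End_ggroup G) x\<^esub> g = \<one>\<^bsub>grp (End_ggroup G) x\<^esub>"
    by (intro bexI[of _ "ginv G g"]) (auto simp: End_simps)
qed (auto simp: End_simps Comp_assoc)

end

text \<open>
  The conditions on \<open>N\<close> concern objects of \<open>G\<close> only. The locale therefore applies to any family that
  agrees on objects with the image of the boundary from dimension 2, and there are three of them
  below: the one of a complex, the one of a truncation, and the one of a crossed module.
\<close>
locale normal_subgroupoid = small_groupoid G for G :: "('o, 'a) groupoid" +
  fixes N :: "'o \<Rightarrow> 'a set"
  assumes vertex_subgroup: "x \<in> Obj G \<Longrightarrow> subgroup (N x) (grp (End_ggroup G) x)"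
    and conj_closed: "\<lbrakk>g \<in> Arr G; u \<in> N (Dom G g)\<rbrakk> \<Longrightarrow> Comp G (Comp G g u) (ginv G g) \<in> N (Cod G g)"
begin

lemma N_loop:
  assumes "x \<in> Obj G" "u \<in> N x"
  shows "u \<in> Arr G" "Dom G u = x" "Cod G u = x"
  using subgroup.mem_carrier[OF vertex_subgroup, of x u] assms by (auto simp: End_simps)

lemma Idn_N: "x \<in> Obj G \<Longrightarrow> Idn G x \<in> N x"
  using subgroup.one_closed[OF vertex_subgroup] by (simp add: End_simps)

lemma Comp_N: "\<lbrakk>x \<in> Obj G; u \<in> N x; v \<in> N x\<rbrakk> \<Longrightarrow> Comp G u v \<in> N x"
  using subgroup.m_closed[OF vertex_subgroup, of x u v] by (simp add: End_simps)

lemma N_left_inverse: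
  assumes "x \<in> Obj G" "u \<in> N x"
  obtains v where "v \<in> N x" "Comp G u v = Idn G x"
proof
  have u: "u \<in> carrier (grp (End_ggroup G) x)"
    using subgroup.mem_carrier[OF vertex_subgroup] assms by blast
  show "inv\<^bsub>grp (End_ggroup G) x\<^esub> u \<in> N x"
    by (rule subgroup.m_inv_closed[OF vertex_subgroup]) fact+
  show "Comp G u (inv\<^bsub>grp (End_ggroup G) x\<^esub> u) = Idn G x"
    using group.r_inv[OF group_End[OF assms(1)] u] by (simp add: End_simps)
qed

lemma gcoset_iff: "f \<in> gcoset G N g \<longleftrightarrow> (\<exists>u\<in>N (Dom G g). f = Comp G g u)"
  by (auto simp: gcoset_def)

lemma gcoset_self: "g \<in> Arr G \<Longrightarrow> g \<in> gcoset G N g"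
  using Idn_N[of "Dom G g"] by (force simp: gcoset_iff)

lemma gcoset_parallel:
  assumes "g \<in> Arr G" "f \<in> gcoset G N g"
  shows "f \<in> Arr G" "Dom G f = Dom G g" "Cod G f = Cod G g"
proof -
  obtain u where "u \<in> N (Dom G g)" "f = Comp G g u" using assms by (auto simp: gcoset_iff)
  then show "f \<in> Arr G" "Dom G f = Dom G g" "Cod G f = Cod G g"
    using assms(1) N_loop[of "Dom G g" u] by auto
qed

lemma gcoset_eqI:
  assumes g: "g \<in> Arr G" and f: "f \<in> gcoset G N g"
  shows "gcoset G N f = gcoset G N g"
proof -
  obtain u where u: "u \<in> N (Dom G g)" "f = Comp G g u" using f by (auto simp: gcoset_iff)
  have D: "Dom G g \<in> Obj G" using g by simp
  obtain v where v: "v \<in> N (Dom G g)" "Comp G u v = Idn G (Dom G g)"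
    using N_left_inverse[OF D u(1)] by blast
  have g_eq: "g = Comp G f v"
    using g u v N_loop[OF D] by (simp add: Comp_assoc)
  have "Comp G f w \<in> gcoset G N g" if w: "w \<in> N (Dom G g)" for w
    unfolding gcoset_iff
    using g u w N_loop[OF D] Comp_N[OF D u(1) w] by (intro bexI[of _ "Comp G u w"]) (auto simp: Comp_assoc)
  moreover have "Comp G g w \<in> gcoset G N f" if w: "w \<in> N (Dom G g)" for w
  proof -
    have "Comp G g w = Comp G f (Comp G v w)"
      unfolding g_eq using gcoset_parallel[OF g f] v w N_loop[OF D] by (simp add: Comp_assoc)
    then show ?thesis
      unfolding gcoset_iff using gcoset_parallel[OF g f] Comp_N[OF D v(1) w] by auto
  qed
  ultimately show ?thesis
    using gcoset_parallel[OF g f] by (auto simp: gcoset_iff)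
qed

lemma gcoset_Idn: "x \<in> Obj G \<Longrightarrow> gcoset G N (Idn G x) = N x"
  using N_loop[of x] by (force simp: gcoset_def)

text \<open>
  Conjugation by the inverse of \<open>f\<close> gives the element on the other side. This is where normality enters
  the composition of cosets.
\<close>
lemma N_shift:
  assumes f: "f \<in> Arr G" and u: "u \<in> N (Cod G f)"
  obtains v where "v \<in> N (Dom G f)" "Comp G u f = Comp G f v"
proof
  let ?v = "Comp G (Comp G (ginv G f) u) f"
  show "?v \<in> N (Dom G f)" using conj_closed[of "ginv G f" u] f u by simp
  have "Comp G f ?v = Comp G (Comp G (Comp G f (ginv G f)) u) f"
    using f N_loop[OF Cod_Obj[OF f] u] by (simp add: Comp_assoc del: ginv_right)
  also have "\<dots> = Comp G u f" using f N_loop[OF Cod_Obj[OF f] u] by simp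
  finally show "Comp G u f = Comp G f ?v" by simp
qed

abbreviation "Q \<equiv> quotient_groupoid G N"

lemma Q_simps:
  "Obj Q = Obj G" "Arr Q = gcoset G N ` Arr G" "Idn Q = N"
  "Comp Q X Y = {Comp G g f | g f. g \<in> X \<and> f \<in> Y}"
  by (simp_all add: quotient_groupoid_def)

lemma Dom_Cod_gcoset [simp]:
  assumes g: "g \<in> Arr G"
  shows "Dom Q (gcoset G N g) = Dom G g" "Cod Q (gcoset G N g) = Cod G g"
proof -
  have "Dom G ` gcoset G N g = {Dom G g}"
    using gcoset_self[OF g] gcoset_parallel(2)[OF g] by blast
  moreover have "Cod G ` gcoset G N g = {Cod G g}"
    using gcoset_self[OF g] gcoset_parallel(3)[OF g] by blast
  ultimately show "Dom Q (gcoset G N g) = Dom G g" "Cod Q (gcoset G N g) = Cod G g"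
    by (simp_all add: quotient_groupoid_def)
qed

lemma Comp_gcoset:
  assumes g: "g \<in> Arr G" and f: "f \<in> Arr G" and gf: "Dom G g = Cod G f"
  shows "Comp Q (gcoset G N g) (gcoset G N f) = gcoset G N (Comp G g f)"
proof (intro equalityI subsetI)
  fix h assume "h \<in> Comp Q (gcoset G N g) (gcoset G N f)"
  then obtain u v where u: "u \<in> N (Cod G f)" and v: "v \<in> N (Dom G f)"
    and h: "h = Comp G (Comp G g u) (Comp G f v)"
    using gf by (auto simp: Q_simps gcoset_iff)
  obtain u' where u': "u' \<in> N (Dom G f)" "Comp G u f = Comp G f u'"
    using N_shift[OF f u] by blast
  note loops = N_loop[OF Cod_Obj[OF f] u] N_loop[OF Dom_Obj[OF f] v] N_loop[OF Dom_Obj[OF f] u'(1)]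
  have "h = Comp G g (Comp G (Comp G u f) v)"
    unfolding h using g f gf loops by (simp add: Comp_assoc)
  also have "\<dots> = Comp G (Comp G g f) (Comp G u' v)"
    unfolding u' using g f gf loops by (simp add: Comp_assoc)
  finally show "h \<in> gcoset G N (Comp G g f)"
    using g f gf Comp_N[OF Dom_Obj[OF f] u'(1) v] by (auto simp: gcoset_iff)
next
  fix h assume "h \<in> gcoset G N (Comp G g f)"
  then obtain u where u: "u \<in> N (Dom G f)" "h = Comp G (Comp G g f) u"
    using g f gf by (auto simp: gcoset_iff)
  then have "h = Comp G g (Comp G f u)"
    using g f gf N_loop[OF Dom_Obj[OF f]] by (simp add: Comp_assoc)
  then show "h \<in> Comp Q (gcoset G N g) (gcoset G N f)"
    using gcoset_self[OF g] u by (auto simp: Q_simps gcoset_iff)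
qed

lemma is_groupoid_Q: "is_groupoid Q"
proof -
  have inverse: "\<exists>h\<in>Arr G. Dom G h = Cod G g \<and> Cod G h = Dom G g \<and>
      Comp Q (gcoset G N h) (gcoset G N g) = N (Dom G g) \<and>
      Comp Q (gcoset G N g) (gcoset G N h) = N (Cod G g)" if "g \<in> Arr G" for g
    using that by (intro bexI[of _ "ginv G g"]) (auto simp: Comp_gcoset gcoset_Idn)
  have N_eq: "N x = gcoset G N (Idn G x)" if "x \<in> Obj G" for x
    using that by (simp add: gcoset_Idn)
  have units: "Comp Q (gcoset G N g) (N (Dom G g)) = gcoset G N g"
    "Comp Q (N (Cod G g)) (gcoset G N g) = gcoset G N g" if "g \<in> Arr G" for g
    using that by (simp_all add: N_eq Comp_gcoset)
  have N_Dom: "Dom Q (N x) = x" "Cod Q (N x) = x" if "x \<in> Obj G" for x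
    using that by (simp_all add: N_eq)
  have N_Arr: "N x \<in> gcoset G N ` Arr G" if "x \<in> Obj G" for x
    using that by (auto simp: N_eq)
  show ?thesis
    unfolding is_groupoid_def Q_simps(1-3)
  proof (intro conjI ballI impI)
    fix X assume "X \<in> gcoset G N ` Arr G"
    then show "\<exists>Y\<in>gcoset G N ` Arr G. Dom Q Y = Cod Q X \<and> Cod Q Y = Dom Q X \<and>
        Comp Q Y X = N (Dom Q X) \<and> Comp Q X Y = N (Cod Q X)"
      using inverse by force
  qed (auto simp: N_Arr N_Dom Comp_gcoset Comp_assoc units)
qed

lemma is_functor_gcoset: "is_functor G Q (\<lambda>x. x) (gcoset G N)"
  by (auto simp: is_functor_def Q_simps(1-3) Comp_gcoset gcoset_Idn)

lemma functor_kernel_gcoset: "functor_kernel G Q (gcoset G N) = (\<Union>x\<in>Obj G. N x)"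
proof -
  have "g \<in> N x" if "g \<in> Arr G" "gcoset G N g = N x" for g x
    using gcoset_self[OF that(1)] that(2) by simp
  moreover have "gcoset G N g = N x" if "x \<in> Obj G" "g \<in> N x" for g x
    using gcoset_eqI[of "Idn G x" g] that by (simp add: gcoset_Idn)
  ultimately show ?thesis
    unfolding functor_kernel_def Q_simps(1,3) using N_loop(1) by blast
qed

end

section \<open>Quotients of crossed modules\<close>

locale xmodule = small_groupoid G for G :: "('o, 'a) groupoid" +
  fixes M :: "('o, 'a, 'c) xmod"
  assumes crossed: "crossed_module G M"
begin

lemma ggroup: "is_ggroup G M"
  using crossed by (simp add: crossed_module_def)

lemma vertex_group: "x \<in> Obj G \<Longrightarrow> group (grp M x)"
  using ggroup by (simp add: is_ggroup_def)

lemma act_hom: "g \<in> Arr G \<Longrightarrow> act M g \<in> hom (grp M (Dom G g)) (grp M (Cod G g))"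
  using ggroup by (simp add: is_ggroup_def)

lemma act_group_hom: "g \<in> Arr G \<Longrightarrow> group_hom (grp M (Dom G g)) (grp M (Cod G g)) (act M g)"
  by (simp add: group_hom_def group_hom_axioms_def vertex_group act_hom)

lemma act_closed: "\<lbrakk>g \<in> Arr G; u \<in> carrier (grp M (Dom G g))\<rbrakk> \<Longrightarrow> act M g u \<in> carrier (grp M (Cod G g))"
  using act_hom[of g] by (auto simp: hom_def)

lemma act_mult:
  "\<lbrakk>g \<in> Arr G; u \<in> carrier (grp M (Dom G g)); v \<in> carrier (grp M (Dom G g))\<rbrakk>
    \<Longrightarrow> act M g (u \<otimes>\<^bsub>grp M (Dom G g)\<^esub> v) = act M g u \<otimes>\<^bsub>grp M (Cod G g)\<^esub> act M g v"
  using act_hom[of g] by (auto simp: hom_def)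

lemma mult_closed:
  "\<lbrakk>x \<in> Obj G; u \<in> carrier (grp M x); v \<in> carrier (grp M x)\<rbrakk> \<Longrightarrow> u \<otimes>\<^bsub>grp M x\<^esub> v \<in> carrier (grp M x)"
  using vertex_group by (simp add: group.is_monoid monoid.m_closed)

lemma act_Idn: "\<lbrakk>x \<in> Obj G; u \<in> carrier (grp M x)\<rbrakk> \<Longrightarrow> act M (Idn G x) u = u"
  using ggroup by (simp add: is_ggroup_def)

lemma act_Comp: "\<lbrakk>g \<in> Arr G; f \<in> Arr G; Dom G g = Cod G f; u \<in> carrier (grp M (Dom G f))\<rbrakk>
    \<Longrightarrow> act M (Comp G g f) u = act M g (act M f u)"
  using ggroup by (simp add: is_ggroup_def)

lemma act_ginv:
  "\<lbrakk>g \<in> Arr G; u \<in> carrier (grp M (Cod G g))\<rbrakk> \<Longrightarrow> act M g (act M (ginv G g) u) = u"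
  using act_Comp[of g "ginv G g" u] by (simp add: act_Idn)

lemma del_natural_hom: "ggroup_hom G M (End_ggroup G) (del M)"
  using crossed by (simp add: crossed_module_def)

lemma del_group_hom: "x \<in> Obj G \<Longrightarrow> group_hom (grp M x) (grp (End_ggroup G) x) (del M x)"
  using del_natural_hom
  by (simp add: group_hom_def group_hom_axioms_def vertex_group group_End ggroup_hom_def)

lemma del_loop:
  "\<lbrakk>x \<in> Obj G; u \<in> carrier (grp M x)\<rbrakk> \<Longrightarrow> del M x u \<in> Arr G \<and> Dom G (del M x u) = x \<and> Cod G (del M x u) = x"
  using group_hom.hom_closed[OF del_group_hom, of x u] by (simp add: End_simps)

lemma del_mult:
  "\<lbrakk>x \<in> Obj G; u \<in> carrier (grp M x); v \<in> carrier (grp M x)\<rbrakk>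
    \<Longrightarrow> del M x (u \<otimes>\<^bsub>grp M x\<^esub> v) = Comp G (del M x u) (del M x v)"
  using group_hom.hom_mult[OF del_group_hom, of x u v] by (simp add: End_simps)

lemma del_act:
  "\<lbrakk>g \<in> Arr G; u \<in> carrier (grp M (Dom G g))\<rbrakk>
    \<Longrightarrow> del M (Cod G g) (act M g u) = Comp G (Comp G g (del M (Dom G g) u)) (ginv G g)"
  using del_natural_hom by (simp add: ggroup_hom_def End_simps)

lemma peiffer:
  "\<lbrakk>x \<in> Obj G; u \<in> carrier (grp M x); v \<in> carrier (grp M x)\<rbrakk>
    \<Longrightarrow> act M (del M x u) v = u \<otimes>\<^bsub>grp M x\<^esub> v \<otimes>\<^bsub>grp M x\<^esub> inv\<^bsub>grp M x\<^esub> u"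
  using crossed by (simp add: crossed_module_def)

text \<open>
  By the Peiffer identity conjugation by \<open>u\<close> is the action of \<open>\<delta> u\<close>, here an identity arrow.
\<close>
lemma ker_del_central:
  assumes x: "x \<in> Obj G" and u: "u \<in> carrier (grp M x)" "del M x u = Idn G x"
    and v: "v \<in> carrier (grp M x)"
  shows "u \<otimes>\<^bsub>grp M x\<^esub> v = v \<otimes>\<^bsub>grp M x\<^esub> u"
proof -
  interpret group "grp M x" using x by (rule vertex_group)
  have "u \<otimes>\<^bsub>grp M x\<^esub> v \<otimes>\<^bsub>grp M x\<^esub> inv\<^bsub>grp M x\<^esub> u = v"
    using peiffer[OF x u(1) v] act_Idn[OF x v] u(2) by simp
  then show ?thesis using u v by (metis inv_solve_right m_closed)
qed

text \<open>
  Naturality of \<open>\<delta>\<close> says that conjugating \<open>\<delta> c\<close> by \<open>g\<close> yields \<open>\<delta>\<close> of \<open>g\<close> acting on \<open>c\<close>.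
\<close>
lemma normal_subgroupoid_image:
  assumes N: "\<And>x. x \<in> Obj G \<Longrightarrow> N x = xmod_image M x"
  shows "normal_subgroupoid G N"
proof (intro normal_subgroupoid.intro normal_subgroupoid_axioms.intro small_groupoid_axioms)
  show "subgroup (N x) (grp (End_ggroup G) x)" if "x \<in> Obj G" for x
    using group_hom.img_is_subgroup[OF del_group_hom[OF that]] N[OF that] by (simp add: xmod_image_def)
  show "Comp G (Comp G g u) (ginv G g) \<in> N (Cod G g)" if g: "g \<in> Arr G" and u: "u \<in> N (Dom G g)" for g u
  proof -
    obtain c where c: "c \<in> carrier (grp M (Dom G g))" "u = del M (Dom G g) c"
      using u g by (auto simp: N xmod_image_def)
    then show ?thesis
      using g del_act[OF g c(1)] act_closed[OF g c(1)] by (metis Cod_Obj N imageI xmod_image_def)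
  qed
qed

end

lemma xmoduleI: "crossed_module G M \<Longrightarrow> xmodule G M"
  by unfold_locales (simp_all add: crossed_module_def)

definition sub_xmod :: "('o, 'a, 'c) xmod \<Rightarrow> ('o \<Rightarrow> 'c set) \<Rightarrow> ('o, 'a, 'c) xmod" where
  "sub_xmod M Z = M\<lparr>grp := \<lambda>x. (grp M x)\<lparr>carrier := Z x\<rparr>\<rparr>"

lemma (in xmodule) crossed_module_sub:
  assumes sub: "\<And>x. x \<in> Obj G \<Longrightarrow> subgroup (Z x) (grp M x)"
    and stable: "\<And>g u. \<lbrakk>g \<in> Arr G; u \<in> Z (Dom G g)\<rbrakk> \<Longrightarrow> act M g u \<in> Z (Cod G g)"
  shows "crossed_module G (sub_xmod M Z)"
proof -
  have Z: "u \<in> carrier (grp M x)" if "x \<in> Obj G" "u \<in> Z x" for x u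
    using subgroup.mem_carrier[OF sub] that by blast
  have hom: "act M g (u \<otimes>\<^bsub>grp M (Dom G g)\<^esub> v) = act M g u \<otimes>\<^bsub>grp M (Cod G g)\<^esub> act M g v"
    if "g \<in> Arr G" "u \<in> Z (Dom G g)" "v \<in> Z (Dom G g)" for g u v
    using group_hom.hom_mult[OF act_group_hom] that Z by simp
  have "is_ggroup G (sub_xmod M Z)"
    using subgroup.subgroup_is_group[OF sub vertex_group]
    by (auto simp: is_ggroup_def sub_xmod_def stable hom act_Idn act_Comp Z intro!: homI)
  moreover have "ggroup_hom G (sub_xmod M Z) (End_ggroup G) (del M)"
    using del_loop del_mult del_act
    by (auto simp: ggroup_hom_def sub_xmod_def End_simps Z intro!: homI)
  ultimately show ?thesis
    using groupoid group.m_inv_consistent[OF vertex_group sub]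
    by (auto simp: crossed_module_def sub_xmod_def peiffer Z)
qed

text \<open>
  Normality of \<open>N x\<close> is a consequence: being killed by \<open>\<delta>\<close>, its elements are central.
\<close>
locale xmod_quotient = xmodule G M for G :: "('o, 'a) groupoid" and M :: "('o, 'a, 'c) xmod" +
  fixes N :: "'o \<Rightarrow> 'c set"
  assumes N_subgroup: "x \<in> Obj G \<Longrightarrow> subgroup (N x) (grp M x)"
    and N_stable: "\<lbrakk>g \<in> Arr G; u \<in> N (Dom G g)\<rbrakk> \<Longrightarrow> act M g u \<in> N (Cod G g)"
    and N_killed: "\<lbrakk>x \<in> Obj G; u \<in> N x\<rbrakk> \<Longrightarrow> del M x u = Idn G x"
begin

lemma N_carrier: "\<lbrakk>x \<in> Obj G; u \<in> N x\<rbrakk> \<Longrightarrow> u \<in> carrier (grp M x)"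
  using subgroup.mem_carrier[OF N_subgroup] by blast

lemma N_normal:
  assumes x: "x \<in> Obj G"
  shows "N x \<lhd> grp M x"
proof -
  interpret group "grp M x" using x by (rule vertex_group)
  have "v \<otimes>\<^bsub>grp M x\<^esub> u \<otimes>\<^bsub>grp M x\<^esub> inv\<^bsub>grp M x\<^esub> v = u" if "u \<in> N x" "v \<in> carrier (grp M x)" for u v
    using ker_del_central[OF x N_carrier[OF x] N_killed[OF x], of u v] that N_carrier[OF x]
    by (metis inv_solve_right m_closed)
  then show ?thesis using N_subgroup[OF x] by (simp add: normal_inv_iff)
qed

abbreviation "cls x u \<equiv> N x #>\<^bsub>grp M x\<^esub> u"
abbreviation "QM \<equiv> quotient_xmod M N"

lemma carrier_QM: "carrier (grp QM x) = cls x ` carrier (grp M x)"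
  by (auto simp: quotient_xmod_def FactGroup_def RCOSETS_def)

lemma group_QM: "x \<in> Obj G \<Longrightarrow> group (grp QM x)"
  using normal.factorgroup_is_group[OF N_normal] by (simp add: quotient_xmod_def)

lemma mult_cls:
  "\<lbrakk>x \<in> Obj G; u \<in> carrier (grp M x); v \<in> carrier (grp M x)\<rbrakk>
    \<Longrightarrow> cls x u \<otimes>\<^bsub>grp QM x\<^esub> cls x v = cls x (u \<otimes>\<^bsub>grp M x\<^esub> v)"
  using normal.rcos_sum[OF N_normal, of x u v] by (simp add: quotient_xmod_def FactGroup_def)

lemma inv_cls:
  "\<lbrakk>x \<in> Obj G; u \<in> carrier (grp M x)\<rbrakk> \<Longrightarrow> inv\<^bsub>grp QM x\<^esub> (cls x u) = cls x (inv\<^bsub>grp M x\<^esub> u)"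
  using normal.inv_FactGroup[OF N_normal, of x "cls x u"] normal.rcos_inv[OF N_normal, of x u]
    carrier_QM[of x]
  by (auto simp: quotient_xmod_def)

lemma cls_self: "\<lbrakk>x \<in> Obj G; u \<in> carrier (grp M x)\<rbrakk> \<Longrightarrow> u \<in> cls x u"
  using group.rcos_self[OF vertex_group _ N_subgroup] by blast

lemma cls_eq_N_iff: "\<lbrakk>x \<in> Obj G; u \<in> carrier (grp M x)\<rbrakk> \<Longrightarrow> cls x u = N x \<longleftrightarrow> u \<in> N x"
  using group.coset_join1[OF vertex_group _ _ N_subgroup] group.coset_join2[OF vertex_group _ N_subgroup]
  by blast

text \<open>
  Arrows are invertible, so stability gives that \<open>g\<close> maps \<open>N\<close> onto \<open>N\<close>; hence the image of a coset is a
  whole coset and not only a subset of one.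
\<close>
lemma act_cls:
  assumes g: "g \<in> Arr G" and u: "u \<in> carrier (grp M (Dom G g))"
  shows "act QM g (cls (Dom G g) u) = cls (Cod G g) (act M g u)"
proof -
  have "act M g (n \<otimes>\<^bsub>grp M (Dom G g)\<^esub> u) = act M g n \<otimes>\<^bsub>grp M (Cod G g)\<^esub> act M g u"
    if "n \<in> N (Dom G g)" for n
    using group_hom.hom_mult[OF act_group_hom[OF g]] u N_carrier[OF Dom_Obj[OF g] that] by simp
  then have "act QM g (cls (Dom G g) u)
      = (\<lambda>n. n \<otimes>\<^bsub>grp M (Cod G g)\<^esub> act M g u) ` act M g ` N (Dom G g)"
    unfolding quotient_xmod_def r_coset_def by (auto simp: image_iff)
  also have "act M g ` N (Dom G g) = N (Cod G g)"
  proof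
    show "act M g ` N (Dom G g) \<subseteq> N (Cod G g)" using N_stable[OF g] by blast
    show "N (Cod G g) \<subseteq> act M g ` N (Dom G g)"
    proof
      fix n assume n: "n \<in> N (Cod G g)"
      have "act M g (act M (ginv G g) n) = n"
        using act_ginv[OF g] N_carrier[OF Cod_Obj[OF g] n] by blast
      moreover have "act M (ginv G g) n \<in> N (Dom G g)"
        using N_stable[of "ginv G g" n] g n by simp
      ultimately show "n \<in> act M g ` N (Dom G g)" by force
    qed
  qed
  finally show ?thesis
    unfolding r_coset_def by blast
qed

text \<open>
  A homomorphism that kills \<open>N\<close> is constant on each coset. Induced maps written as images of cosets are
  computed with this: the result is a singleton.
\<close>
lemma image_cls:
  assumes x: "x \<in> Obj G" and u: "u \<in> carrier (grp M x)"
    and \<alpha>: "\<alpha> \<in> hom (grp M x) H" and H: "group H" and "\<And>n. n \<in> N x \<Longrightarrow> \<alpha> n = \<one>\<^bsub>H\<^esub>"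
  shows "\<alpha> ` cls x u = {\<alpha> u}"
proof -
  have "\<alpha> v = \<alpha> u" if "v \<in> cls x u" for v
  proof -
    obtain n where n: "n \<in> N x" "v = n \<otimes>\<^bsub>grp M x\<^esub> u" using \<open>v \<in> cls x u\<close> by (auto simp: r_coset_def)
    interpret \<alpha>: group_hom "grp M x" H \<alpha>
      by (simp add: group_hom_def group_hom_axioms_def x vertex_group H \<alpha>)
    show ?thesis using n u assms(5)[OF n(1)] N_carrier[OF x n(1)] by simp
  qed
  then show ?thesis using cls_self[OF x u] by blast
qed

lemma del_cls:
  assumes x: "x \<in> Obj G" and u: "u \<in> carrier (grp M x)"
  shows "del QM x (cls x u) = del M x u"
proof -
  have "del M x ` cls x u = {del M x u}"
    using group_hom.homh[OF del_group_hom[OF x]] group_End[OF x] N_killed[OF x]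
    by (intro image_cls[OF x u]) (auto simp: End_simps)
  then show ?thesis by (simp add: quotient_xmod_def)
qed

lemma crossed_module_QM: "crossed_module G QM"
proof -
  have act_Idn_cls: "act QM (Idn G x) (cls x u) = cls x u"
    if "x \<in> Obj G" "u \<in> carrier (grp M x)" for x u
    using act_cls[of "Idn G x" u] that by (simp add: act_Idn)
  have act_Comp_cls: "act QM (Comp G g f) (cls (Dom G f) u) = cls (Cod G g) (act M g (act M f u))"
    if "g \<in> Arr G" "f \<in> Arr G" "Dom G g = Cod G f" "u \<in> carrier (grp M (Dom G f))" for g f u
    using act_cls[of "Comp G g f" u] that by (simp add: act_Comp)
  have act_act_cls: "act QM g (cls (Cod G f) (act M f u)) = cls (Cod G g) (act M g (act M f u))"
    if "g \<in> Arr G" "f \<in> Arr G" "Dom G g = Cod G f" "u \<in> carrier (grp M (Dom G f))" for g f u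
    using act_cls[of g "act M f u"] act_closed[of f u] that by simp
  have "act QM g \<in> hom (grp QM (Dom G g)) (grp QM (Cod G g))" if "g \<in> Arr G" for g
    using that
    by (intro homI) (auto simp: carrier_QM mult_cls act_cls act_closed act_mult mult_closed)
  then have "is_ggroup G QM"
    by (simp add: is_ggroup_def group_QM carrier_QM act_cls act_Idn_cls act_Comp_cls act_act_cls)
  moreover have "del QM x \<in> hom (grp QM x) (grp (End_ggroup G) x)" if "x \<in> Obj G" for x
    using that
    by (intro homI) (auto simp: carrier_QM mult_cls del_cls del_mult mult_closed del_loop End_simps)
  then have "ggroup_hom G QM (End_ggroup G) (del QM)"
    by (simp add: ggroup_hom_def carrier_QM act_cls del_cls del_act act_closed End_simps)
  moreover have "act QM (del QM x (cls x u)) (cls x v)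
      = cls x u \<otimes>\<^bsub>grp QM x\<^esub> cls x v \<otimes>\<^bsub>grp QM x\<^esub> inv\<^bsub>grp QM x\<^esub> (cls x u)"
    if "x \<in> Obj G" "u \<in> carrier (grp M x)" "v \<in> carrier (grp M x)" for x u v
    using that del_loop[of x u] act_cls[of "del M x u" v]
    by (simp add: del_cls inv_cls mult_cls peiffer mult_closed
        group.inv_closed[OF vertex_group])
  ultimately show ?thesis
    using groupoid by (auto simp: crossed_module_def carrier_QM)
qed

end

section \<open>Morphisms of crossed modules\<close>

lemma is_functor_id: "is_groupoid G \<Longrightarrow> is_functor G G (\<lambda>x. x) (\<lambda>g. g)"
  by (simp add: is_functor_def is_groupoid_def)

lemma pullback_sel [simp]:
  "grp (pullback fo fa A) x = grp A (fo x)" "act (pullback fo fa A) g = act A (fa g)"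
  by (simp_all add: pullback_def)

lemma xmod_hom_closed:
  assumes "xmod_hom G M G' M' fo fa \<alpha>" "x \<in> Obj G" "u \<in> carrier (grp M x)"
  shows "\<alpha> x u \<in> carrier (grp M' (fo x))"
  using assms by (auto simp: xmod_hom_def ggroup_hom_def intro: hom_in_carrier)

lemma zero_xmod_sel [simp]:
  "carrier (grp (zero_xmod G) x) = {undefined}" "\<one>\<^bsub>grp (zero_xmod G) x\<^esub> = undefined"
  "u \<otimes>\<^bsub>grp (zero_xmod G) x\<^esub> v = undefined"
  "act (zero_xmod G) g u = undefined" "del (zero_xmod G) x u = Idn G x"
  by (simp_all add: zero_xmod_def singleton_group_def)

lemma crossed_module_zero:
  assumes "is_groupoid G"
  shows "crossed_module G (zero_xmod G :: ('o, 'a, 'c) xmod)"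
proof -
  interpret small_groupoid G by unfold_locales fact
  have "is_ggroup G (zero_xmod G :: ('o, 'a, 'c) xmod)"
    by (auto simp: is_ggroup_def intro!: homI) (simp add: zero_xmod_def)
  moreover have "ggroup_hom G (zero_xmod G :: ('o, 'a, 'c) xmod) (End_ggroup G) (del (zero_xmod G))"
    by (auto simp: ggroup_hom_def End_simps intro!: homI)
  ultimately show ?thesis
    using assms by (simp add: crossed_module_def)
qed

lemma is_zero_xmod_zero: "is_groupoid G \<Longrightarrow> is_zero_xmod G (zero_xmod G)"
  by (simp add: is_zero_xmod_def crossed_module_zero)

lemma ggroup_hom_cong:
  assumes "is_ggroup G M" and h: "ggroup_hom G M M' \<alpha>"
    and eq: "\<And>x u. \<lbrakk>x \<in> Obj G; u \<in> carrier (grp M x)\<rbrakk> \<Longrightarrow> \<beta> x u = \<alpha> x u"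
    and G: "is_groupoid G"
  shows "ggroup_hom G M M' \<beta>"
proof -
  have closed: "u \<otimes>\<^bsub>grp M x\<^esub> v \<in> carrier (grp M x)"
    if "x \<in> Obj G" "u \<in> carrier (grp M x)" "v \<in> carrier (grp M x)" for x u v
    using assms(1) that by (simp add: is_ggroup_def group.is_monoid monoid.m_closed)
  have act: "act M g u \<in> carrier (grp M (Cod G g))" "Dom G g \<in> Obj G" "Cod G g \<in> Obj G"
    if "g \<in> Arr G" "u \<in> carrier (grp M (Dom G g))" for g u
    using assms(1) G that by (auto simp: is_ggroup_def is_groupoid_def hom_def)
  have "\<beta> x \<in> hom (grp M x) (grp M' x)" if "x \<in> Obj G" for x
    using h that closed by (simp add: ggroup_hom_def hom_def eq Pi_iff)
  then show ?thesis
    using h act by (simp add: ggroup_hom_def eq)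
qed

lemma xmod_hom_cong:
  assumes "crossed_module G M" "xmod_hom G M G' M' fo fa \<alpha>"
    and "\<And>x u. \<lbrakk>x \<in> Obj G; u \<in> carrier (grp M x)\<rbrakk> \<Longrightarrow> \<beta> x u = \<alpha> x u"
  shows "xmod_hom G M G' M' fo fa \<beta>"
  using assms ggroup_hom_cong[of G M "pullback fo fa M'" \<alpha> \<beta>]
  by (simp add: xmod_hom_def crossed_module_def)

text \<open>
  Boundaries of truncations and components of \<open>\<eta>\<close> that start or end in a vanishing dimension are of
  this kind. The condition on \<open>del\<close> holds in dimension at least 3 over the identity of \<open>G\<close>, and in all dimensions
  after passage to \<open>\<pi>\<^sub>1\<close>.
\<close>
lemma xmod_hom_trivial:
  assumes M: "crossed_module G M" and M': "crossed_module G' M'" and f: "is_functor G G' fo fa"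
    and del: "\<And>x u. \<lbrakk>x \<in> Obj G; u \<in> carrier (grp M x)\<rbrakk> \<Longrightarrow> fa (del M x u) = Idn G' (fo x)"
  shows "xmod_hom G M G' M' fo fa (\<lambda>x u. \<one>\<^bsub>grp M' (fo x)\<^esub>)"
proof -
  interpret M: xmodule G M using M by (rule xmoduleI)
  interpret M': xmodule G' M' using M' by (rule xmoduleI)
  have f': "fo x \<in> Obj G'" if "x \<in> Obj G" for x using f that by (simp add: is_functor_def)
  have fg: "fa g \<in> Arr G'" "Dom G' (fa g) = fo (Dom G g)" "Cod G' (fa g) = fo (Cod G g)"
    if "g \<in> Arr G" for g
    using f that by (auto simp: is_functor_def)
  have "act M' (fa g) \<one>\<^bsub>grp M' (fo (Dom G g))\<^esub> = \<one>\<^bsub>grp M' (fo (Cod G g))\<^esub>" if "g \<in> Arr G" for g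
    using group_hom.hom_one[OF M'.act_group_hom[of "fa g"]] fg[OF that] by simp
  moreover have "del M' (fo x) \<one>\<^bsub>grp M' (fo x)\<^esub> = Idn G' (fo x)" if "x \<in> Obj G" for x
    using group_hom.hom_one[OF M'.del_group_hom[OF f'[OF that]]] by (simp add: M'.End_simps)
  moreover have "(\<lambda>u. \<one>\<^bsub>grp M' (fo x)\<^esub>) \<in> hom (grp M x) (grp M' (fo x))" if "x \<in> Obj G" for x
    using M'.vertex_group[OF f'[OF that]]
    by (intro homI) (simp_all add: group.is_monoid monoid.one_closed monoid.r_one)
  ultimately show ?thesis
    using f del by (simp add: xmod_hom_def ggroup_hom_def)
qed

text \<open>
  Both the boundaries of \<open>P\<^sub>n\<close> and the components of \<open>\<eta>\<close> are obtained from this. That \<open>\<alpha>\<close> descends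
  to cosets is contained in the equation for \<open>\<phi>\<close>, which leaves the freedom to write \<open>\<phi>\<close> as an image or
  through a representative.
\<close>
lemma quotient_xmod_hom:
  assumes MN: "xmod_quotient G M N" and MN': "xmod_quotient G M' N'"
    and \<alpha>: "xmod_hom_over G M M' \<alpha>"
    and \<phi>: "\<And>x u. \<lbrakk>x \<in> Obj G; u \<in> carrier (grp M x)\<rbrakk>
      \<Longrightarrow> \<phi> x (N x #>\<^bsub>grp M x\<^esub> u) = N' x #>\<^bsub>grp M' x\<^esub> \<alpha> x u"
  shows "xmod_hom_over G (quotient_xmod M N) (quotient_xmod M' N') \<phi>"
proof -
  interpret M: xmod_quotient G M N by fact
  interpret M': xmod_quotient G M' N' by fact
  have hom: "\<alpha> x \<in> hom (grp M x) (grp M' x)" if "x \<in> Obj G" for x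
    using \<alpha> that by (simp add: xmod_hom_def ggroup_hom_def)
  have closed: "\<alpha> x u \<in> carrier (grp M' x)" if "x \<in> Obj G" "u \<in> carrier (grp M x)" for x u
    using hom[of x] that by (auto simp: hom_def)
  have mult: "\<alpha> x (u \<otimes>\<^bsub>grp M x\<^esub> v) = \<alpha> x u \<otimes>\<^bsub>grp M' x\<^esub> \<alpha> x v"
    if "x \<in> Obj G" "u \<in> carrier (grp M x)" "v \<in> carrier (grp M x)" for x u v
    using hom[of x] that by (auto simp: hom_def)
  have nat: "\<alpha> (Cod G g) (act M g u) = act M' g (\<alpha> (Dom G g) u)"
    if "g \<in> Arr G" "u \<in> carrier (grp M (Dom G g))" for g u
    using \<alpha> that by (simp add: xmod_hom_def ggroup_hom_def)
  have del: "del M x u = del M' x (\<alpha> x u)" if "x \<in> Obj G" "u \<in> carrier (grp M x)" for x u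
    using \<alpha> that by (simp add: xmod_hom_def)
  have "\<phi> x \<in> hom (grp M.QM x) (grp M'.QM x)" if "x \<in> Obj G" for x
    using that
    by (intro homI) (auto simp: M.carrier_QM M'.carrier_QM \<phi> closed mult M.mult_cls M'.mult_cls M.mult_closed)
  moreover have "\<phi> (Cod G g) (act M.QM g (M.cls (Dom G g) u)) = act M'.QM g (\<phi> (Dom G g) (M.cls (Dom G g) u))"
    if "g \<in> Arr G" "u \<in> carrier (grp M (Dom G g))" for g u
    using that by (simp add: \<phi> M.act_cls M'.act_cls M.act_closed nat closed)
  moreover have "del M.QM x (M.cls x u) = del M'.QM x (\<phi> x (M.cls x u))"
    if "x \<in> Obj G" "u \<in> carrier (grp M x)" for x u
    using that by (simp add: \<phi> M.del_cls M'.del_cls closed) (rule del)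
  ultimately show ?thesis
    using M.groupoid by (simp add: xmod_hom_def is_functor_id ggroup_hom_def M.carrier_QM)
qed

lemma xmod_hom_over_del:
  assumes "crossed_module G M"
  shows "xmod_hom_over G M (one_xmod G) (del M)"
  using assms by (simp add: xmod_hom_def crossed_module_def is_functor_id one_xmod_def xm_def
      ggroup_hom_def)

lemma crossed_module_cong:
  assumes "crossed_module G M" and "grp L = grp M" "act L = act M"
    and del: "\<And>x u. \<lbrakk>x \<in> Obj G; u \<in> carrier (grp M x)\<rbrakk> \<Longrightarrow> del L x u = del M x u"
  shows "crossed_module G L"
proof -
  have "is_ggroup G L" using assms(1-3) by (simp add: crossed_module_def is_ggroup_def)
  moreover have "ggroup_hom G M (End_ggroup G) (del L)"
    by (rule ggroup_hom_cong[where \<alpha> = "del M"])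
      (use assms(1) in \<open>simp_all add: crossed_module_def del\<close>)
  then have "ggroup_hom G L (End_ggroup G) (del L)"
    by (simp add: ggroup_hom_def assms(2,3))
  ultimately show ?thesis
    using assms(1) by (simp add: crossed_module_def assms(2,3) del)
qed

lemma id_xmod_hom: "crossed_module G M \<Longrightarrow> xmod_hom_over G M M (\<lambda>x u. u)"
  by (simp add: xmod_hom_def ggroup_hom_def hom_def is_functor_id crossed_module_def)

lemma xmod_hom_over_cong:
  assumes "xmod_hom_over G M M' \<alpha>" and "crossed_module G M"
    and "grp L = grp M" "act L = act M" "grp L' = grp M'" "act L' = act M'"
    and "\<And>x u. \<lbrakk>x \<in> Obj G; u \<in> carrier (grp M x)\<rbrakk> \<Longrightarrow> del L x u = del M x u"
    and "\<And>x u. \<lbrakk>x \<in> Obj G; u \<in> carrier (grp M' x)\<rbrakk> \<Longrightarrow> del L' x u = del M' x u"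
    and "\<And>x u. \<lbrakk>x \<in> Obj G; u \<in> carrier (grp M x)\<rbrakk> \<Longrightarrow> \<beta> x u = \<alpha> x u"
  shows "xmod_hom_over G L L' \<beta>"
proof -
  have \<beta>: "xmod_hom_over G M M' \<beta>"
    by (rule xmod_hom_cong[OF assms(2,1)]) (rule assms(9))
  then show ?thesis
    using xmod_hom_closed[OF \<beta>]
    by (simp add: xmod_hom_def ggroup_hom_def assms(3-8))
qed

lemma is_ggroup_cong:
  assumes "is_ggroup G M" "is_groupoid G"
    and "\<And>x. x \<in> Obj G \<Longrightarrow> grp L x = grp M x"
    and "\<And>g u. \<lbrakk>g \<in> Arr G; u \<in> carrier (grp M (Dom G g))\<rbrakk> \<Longrightarrow> act L g u = act M g u"
  shows "is_ggroup G L"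
proof -
  interpret small_groupoid G by unfold_locales fact
  have M: "act M g \<in> hom (grp M (Dom G g)) (grp M (Cod G g))" if "g \<in> Arr G" for g
    using assms(1) that by (simp add: is_ggroup_def)
  have grp: "group (grp M x)" if "x \<in> Obj G" for x
    using assms(1) that by (simp add: is_ggroup_def)
  have "act L g \<in> hom (grp M (Dom G g)) (grp M (Cod G g))" if g: "g \<in> Arr G" for g
    using M[OF g] g grp[OF Dom_Obj[OF g]]
    by (simp add: hom_def Pi_iff assms(4) group.is_monoid monoid.m_closed)
  moreover have "act M f u \<in> carrier (grp M (Dom G g))"
    if "f \<in> Arr G" "Dom G g = Cod G f" "u \<in> carrier (grp M (Dom G f))" for g f u
    using M[of f] that by (auto simp: hom_def)
  ultimately show ?thesis
    using assms(1) by (simp add: is_ggroup_def assms(3,4))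
qed

text \<open>
  Every arrow of \<open>Q\<close> is of the form \<open>q g\<close>, and composable arrows lift to composable arrows because \<open>q\<close>
  is the identity on objects; so each functoriality law for \<open>Q\<close> is one for \<open>G\<close>.
\<close>
lemma is_ggroup_descend:
  assumes G: "is_groupoid G" and A: "is_ggroup G (pullback (\<lambda>x. x) q A)"
    and q: "is_functor G Q (\<lambda>x. x) q" "Obj Q = Obj G" "q ` Arr G = Arr Q"
  shows "is_ggroup Q A"
proof -
  have q': "Dom Q (q g) = Dom G g" "Cod Q (q g) = Cod G g" if "g \<in> Arr G" for g
    using q(1) that by (auto simp: is_functor_def)
  have q_Idn: "Idn Q x = q (Idn G x)" if "x \<in> Obj G" for x
    using q(1) that by (simp add: is_functor_def)
  have q_Comp: "Comp Q (q g) (q f) = q (Comp G g f)" if "g \<in> Arr G" "f \<in> Arr G" "Dom G g = Cod G f" for g f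
    using q(1) that by (simp add: is_functor_def)
  show ?thesis
    using A unfolding is_ggroup_def q(2) q(3)[symmetric]
    by (simp add: q' q_Idn q_Comp)
qed

lemma hat_sel [simp]:
  "Obj (hat X A) = X" "Arr (hat X A) = (SIGMA x:X. carrier (grp A x))"
  "Dom (hat X A) = fst" "Cod (hat X A) = fst" "Idn (hat X A) x = (x, \<one>\<^bsub>grp A x\<^esub>)"
  "Comp (hat X A) p q = (fst p, snd p \<otimes>\<^bsub>grp A (fst p)\<^esub> snd q)"
  by (simp_all add: hat_def)

section \<open>The Postnikov truncations\<close>

locale xcomplex =
  fixes K :: "('o, 'a, 'c) xcomplex"
  assumes complex: "crossed_complex K"
begin

abbreviation "G \<equiv> base K"
abbreviation "C \<equiv> cterm K"

sublocale small_groupoid "base K"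
  by unfold_locales (use complex in \<open>simp add: crossed_complex_def\<close>)

lemma term_xmod: "2 \<le> n \<Longrightarrow> crossed_module G (C n)"
  using complex by (simp add: crossed_complex_def)

lemma term_xmodule: "2 \<le> n \<Longrightarrow> xmodule G (C n)"
  by (intro xmoduleI term_xmod)

lemmas term_group = xmodule.vertex_group[OF term_xmodule]

lemma bd_hom: "3 \<le> n \<Longrightarrow> xmod_hom_over G (C n) (C (n - 1)) (bd K n)"
  using complex by (simp add: crossed_complex_def)

lemma bd_group_hom:
  assumes "3 \<le> n" "x \<in> Obj G"
  shows "group_hom (cgrp K n x) (cgrp K (n - 1) x) (bd K n x)"
  using bd_hom[OF assms(1)] term_group[of n x] term_group[of "n - 1" x] assms
  by (simp add: group_hom_def group_hom_axioms_def xmod_hom_def ggroup_hom_def)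

lemma bd_closed: "\<lbrakk>3 \<le> n; x \<in> Obj G; u \<in> carrier (cgrp K n x)\<rbrakk> \<Longrightarrow> bd K n x u \<in> carrier (cgrp K (n - 1) x)"
  using group_hom.hom_closed[OF bd_group_hom] by blast

lemma bd_act:
  "\<lbrakk>3 \<le> n; g \<in> Arr G; u \<in> carrier (cgrp K n (Dom G g))\<rbrakk>
    \<Longrightarrow> bd K n (Cod G g) (act (C n) g u) = act (C (n - 1)) g (bd K n (Dom G g) u)"
  using bd_hom by (simp add: xmod_hom_def ggroup_hom_def)

lemma del_bd:
  "\<lbrakk>3 \<le> n; x \<in> Obj G; u \<in> carrier (cgrp K n x)\<rbrakk> \<Longrightarrow> del (C (n - 1)) x (bd K n x u) = del (C n) x u"
  using bd_hom by (simp add: xmod_hom_def)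

lemma bd2_eq_del: "\<lbrakk>x \<in> Obj G; u \<in> carrier (cgrp K 2 x)\<rbrakk> \<Longrightarrow> bd2 K x u = del (C 2) x u"
  using complex by (simp add: crossed_complex_def xmod_hom_def one_xmod_def xm_def)

lemma bd_bd:
  "\<lbrakk>3 \<le> n; x \<in> Obj G; u \<in> carrier (cgrp K (n + 1) x)\<rbrakk> \<Longrightarrow> bd K n x (bd K (n + 1) x u) = \<one>\<^bsub>cgrp K (n - 1) x\<^esub>"
  using complex by (simp add: crossed_complex_def)

lemma bd2_bd: "\<lbrakk>x \<in> Obj G; u \<in> carrier (cgrp K 3 x)\<rbrakk> \<Longrightarrow> bd2 K x (bd K 3 x u) = Idn G x"
  using complex by (simp add: crossed_complex_def)

lemma act_bd2:
  "\<lbrakk>3 \<le> n; x \<in> Obj G; w \<in> carrier (cgrp K 2 x); u \<in> carrier (cgrp K n x)\<rbrakk> \<Longrightarrow> act (C n) (bd2 K x w) u = u"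
  using complex by (simp add: crossed_complex_def)

text \<open>
  The boundaries are maps over \<open>G\<close>, so \<open>\<delta>\<close> in dimension \<open>n\<close> factors through \<open>\<partial>\<^sub>2 \<partial>\<^sub>3\<close>.
\<close>
lemma del_trivial:
  assumes "3 \<le> n" "x \<in> Obj G" "u \<in> carrier (cgrp K n x)"
  shows "del (C n) x u = Idn G x"
  using assms
proof (induction n arbitrary: u rule: nat_induct_at_least)
  case base
  then show ?case using del_bd[of 3 x u] bd2_bd[of x u] bd2_eq_del bd_closed[of 3 x u] by simp
next
  case (Suc n)
  then show ?case using del_bd[of "Suc n" x u] bd_closed[of "Suc n" x u] by simp
qed

lemma im2_eq: "x \<in> Obj G \<Longrightarrow> im2 K x = xmod_image (C 2) x"
  by (auto simp: im2_def xmod_image_def bd2_eq_del)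

text \<open>
  The subgroup of \<open>C\<^sub>m\<close> that is divided out in \<open>P\<^sub>n\<close>, for \<open>m \<le> n\<close>. With it the two ways of forming
  terms, quotient in dimension \<open>n\<close> and renaming below, become a single quotient.
\<close>
definition trunc_im :: "nat \<Rightarrow> nat \<Rightarrow> 'o \<Rightarrow> 'c set" where
  "trunc_im n m x = (if m < n then {\<one>\<^bsub>cgrp K m x\<^esub>} else cim K n x)"

text \<open>
  In the top dimension, stability is the naturality of \<open>\<partial>\<^sub>n\<^sub>+\<^sub>1\<close>, and \<open>\<delta>\<close> kills the image because
  \<open>\<delta> \<partial>\<^sub>n\<^sub>+\<^sub>1\<close> is the \<open>\<delta>\<close> of dimension \<open>n + 1 \<ge> 3\<close>.
\<close>
lemma term_quotient:
  assumes "2 \<le> m" "m \<le> n"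
  shows "xmod_quotient G (C m) (trunc_im n m)"
proof -
  interpret M: xmodule G "C m" using assms(1) by (rule term_xmodule)
  show ?thesis
  proof (cases "m < n")
    case True
    have "del (C m) x \<one>\<^bsub>cgrp K m x\<^esub> = Idn G x" if "x \<in> Obj G" for x
      using group_hom.hom_one[OF M.del_group_hom[OF that]] by (simp add: End_simps)
    then show ?thesis
      using group.triv_subgroup[OF M.vertex_group] group_hom.hom_one[OF M.act_group_hom]
      by (intro xmod_quotient.intro xmod_quotient_axioms.intro M.xmodule_axioms)
        (auto simp: trunc_im_def True)
  next
    case False
    then have [simp]: "m = n" using assms by simp
    interpret M1: xmodule G "C (n + 1)" using assms by (intro term_xmodule) simp
    have "subgroup (cim K n x) (cgrp K n x)" if "x \<in> Obj G" for x
      using group_hom.img_is_subgroup[OF bd_group_hom[of "n + 1" x]] assms that by (simp add: cim_def)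
    moreover have "act (C n) g u \<in> cim K n (Cod G g)" if g: "g \<in> Arr G" and u: "u \<in> cim K n (Dom G g)" for g u
    proof -
      obtain v where v: "v \<in> carrier (cgrp K (n + 1) (Dom G g))" "u = bd K (n + 1) (Dom G g) v"
        using u unfolding cim_def by blast
      then have "act (C n) g u = bd K (n + 1) (Cod G g) (act (C (n + 1)) g v)"
        using bd_act[of "n + 1" g v] g assms by simp
      then show ?thesis
        using M1.act_closed[OF g v(1)] by (simp add: cim_def)
    qed
    moreover have "del (C n) x u = Idn G x" if "x \<in> Obj G" "u \<in> cim K n x" for x u
      using that del_bd[of "n + 1" x] del_trivial[of "n + 1" x] assms by (auto simp: cim_def)
    ultimately show ?thesis
      by (intro xmod_quotient.intro xmod_quotient_axioms.intro M.xmodule_axioms)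
        (auto simp: trunc_im_def)
  qed
qed

lemma postnikov_term_quotient:
  "m \<le> n \<Longrightarrow> postnikov_term K n m = quotient_xmod (C m) (trunc_im n m)"
  by (auto simp: postnikov_term_def trunc_im_def[abs_def])

lemma postnikov_term_xmod: "2 \<le> m \<Longrightarrow> crossed_module G (postnikov_term K n m)"
proof (cases "m \<le> n")
  case True
  assume "2 \<le> m"
  with True show ?thesis
    by (simp add: postnikov_term_quotient xmod_quotient.crossed_module_QM term_quotient)
qed (simp add: postnikov_term_def crossed_module_zero groupoid)

lemma trunc_im_one_coset:
  "\<lbrakk>2 \<le> m; m < n; x \<in> Obj G; u \<in> carrier (cgrp K m x)\<rbrakk> \<Longrightarrow> trunc_im n m x #>\<^bsub>cgrp K m x\<^esub> u = {u}"
  using group.is_monoid[OF term_group[of m x]] by (simp add: trunc_im_def r_coset_def monoid.l_one)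

lemma bd_coset:
  assumes "3 \<le> m" "m \<le> n" "x \<in> Obj G" "u \<in> carrier (cgrp K m x)"
  shows "bd K m x ` (trunc_im n m x #>\<^bsub>cgrp K m x\<^esub> u) = {bd K m x u}"
proof (rule xmod_quotient.image_cls[OF term_quotient])
  show "bd K m x v = \<one>\<^bsub>cgrp K (m - 1) x\<^esub>" if "v \<in> trunc_im n m x" for v
    using that group_hom.hom_one[OF bd_group_hom[of m x]] bd_bd[of m x] assms
    by (auto simp: trunc_im_def cim_def split: if_splits)
qed (use assms group_hom.homh[OF bd_group_hom] term_group in auto)

lemma bd2_coset:
  assumes "2 \<le> n" "x \<in> Obj G" "u \<in> carrier (cgrp K 2 x)"
  shows "the_elem (bd2 K x ` (trunc_im n 2 x #>\<^bsub>cgrp K 2 x\<^esub> u)) = bd2 K x u"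
proof -
  interpret M: xmod_quotient G "C 2" "trunc_im n 2" using assms(1) by (intro term_quotient) auto
  have "trunc_im n 2 x #>\<^bsub>cgrp K 2 x\<^esub> u \<subseteq> carrier (cgrp K 2 x)"
    using M.N_carrier[OF assms(2)] assms(3) M.mult_closed[OF assms(2)] by (auto simp: r_coset_def)
  then have "bd2 K x ` (trunc_im n 2 x #>\<^bsub>cgrp K 2 x\<^esub> u) = del (C 2) x ` (trunc_im n 2 x #>\<^bsub>cgrp K 2 x\<^esub> u)"
    using bd2_eq_del[OF assms(2)] by (intro image_cong) auto
  then show ?thesis
    using M.del_cls[OF assms(2,3)] bd2_eq_del[OF assms(2,3)] by (simp add: quotient_xmod_def)
qed

lemma cosetE:
  assumes "2 \<le> m" "m \<le> n" "X \<in> carrier (grp (postnikov_term K n m) x)"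
  obtains u where "u \<in> carrier (cgrp K m x)" "X = trunc_im n m x #>\<^bsub>cgrp K m x\<^esub> u"
  using assms xmod_quotient.carrier_QM[OF term_quotient[OF assms(1,2)], of x]
  by (auto simp: postnikov_term_quotient)

lemma postnikov_sel [simp]:
  "base (postnikov K n) = G" "cterm (postnikov K n) = postnikov_term K n"
  "bd2 (postnikov K n) x X = the_elem (bd2 K x ` X)"
  "bd (postnikov K n) m x X
    = (if m \<le> n then bd K m x ` X else \<one>\<^bsub>grp (postnikov_term K n (m - 1)) x\<^esub>)"
  by (simp_all add: postnikov_def)

lemma postnikov_term_above: "n < m \<Longrightarrow> postnikov_term K n m = zero_xmod G"
  by (simp add: postnikov_term_def)

lemma one_postnikov_term: "m \<le> n \<Longrightarrow> \<one>\<^bsub>grp (postnikov_term K n m) x\<^esub> = trunc_im n m x"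
  by (simp add: postnikov_term_quotient quotient_xmod_def FactGroup_def)

lemma del_postnikov_term:
  assumes "2 \<le> m" "m \<le> n" "x \<in> Obj G" "u \<in> carrier (cgrp K m x)"
  shows "del (postnikov_term K n m) x (trunc_im n m x #>\<^bsub>cgrp K m x\<^esub> u) = del (C m) x u"
  using xmod_quotient.del_cls[OF term_quotient] assms by (simp add: postnikov_term_quotient)

lemma act_postnikov_term:
  assumes "2 \<le> m" "m \<le> n" "g \<in> Arr G" "u \<in> carrier (cgrp K m (Dom G g))"
  shows "act (postnikov_term K n m) g (trunc_im n m (Dom G g) #>\<^bsub>cgrp K m (Dom G g)\<^esub> u)
    = trunc_im n m (Cod G g) #>\<^bsub>cgrp K m (Cod G g)\<^esub> act (C m) g u"
  using xmod_quotient.act_cls[OF term_quotient] assms by (simp add: postnikov_term_quotient)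

lemma del_postnikov_term_trivial:
  assumes "3 \<le> m" "x \<in> Obj G" "X \<in> carrier (grp (postnikov_term K n m) x)"
  shows "del (postnikov_term K n m) x X = Idn G x"
proof (cases "m \<le> n")
  case True
  then obtain u where "u \<in> carrier (cgrp K m x)" "X = trunc_im n m x #>\<^bsub>cgrp K m x\<^esub> u"
    using cosetE[of m n X x] assms by auto
  then show ?thesis
    using True assms del_trivial by (simp add: del_postnikov_term)
qed (simp add: postnikov_term_above)

lemma bd_postnikov_hom:
  assumes "3 \<le> m"
  shows "xmod_hom_over G (postnikov_term K n m) (postnikov_term K n (m - 1)) (bd (postnikov K n) m)"
proof (cases "m \<le> n")
  case True
  have "bd K m x ` (trunc_im n m x #>\<^bsub>cgrp K m x\<^esub> u)
      = trunc_im n (m - 1) x #>\<^bsub>cgrp K (m - 1) x\<^esub> bd K m x u"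
    if "x \<in> Obj G" "u \<in> carrier (cgrp K m x)" for x u
    using that True assms bd_closed[of m x u] by (simp add: bd_coset trunc_im_one_coset)
  then show ?thesis
    using True assms bd_hom[OF assms] term_quotient[of m n] term_quotient[of "m - 1" n]
    by (auto simp: postnikov_term_quotient intro!: quotient_xmod_hom)
next
  case False
  have "xmod_hom_over G (postnikov_term K n m) (postnikov_term K n (m - 1))
      (\<lambda>x X. \<one>\<^bsub>grp (postnikov_term K n (m - 1)) x\<^esub>)"
    using assms del_postnikov_term_trivial
    by (intro xmod_hom_trivial) (auto simp: postnikov_term_xmod is_functor_id groupoid)
  then show ?thesis
    by (rule xmod_hom_cong[rotated]) (use False assms in \<open>auto simp: postnikov_term_xmod\<close>)
qed

text \<open>
  In every crossed complex the boundary to \<open>End\<^sub>G\<close> is \<open>\<delta>\<close>; for the truncation this reduces its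
  properties to those of a crossed module.
\<close>
lemma bd2_postnikov_eq_del:
  assumes "2 \<le> n" "x \<in> Obj G" "X \<in> carrier (grp (postnikov_term K n 2) x)"
  shows "bd2 (postnikov K n) x X = del (postnikov_term K n 2) x X"
  using cosetE[OF order_refl assms(1,3)] assms
  by (metis bd2_coset bd2_eq_del del_postnikov_term order_refl postnikov_sel(3))

lemma bd2_postnikov_hom:
  assumes "2 \<le> n"
  shows "xmod_hom_over G (postnikov_term K n 2) (one_xmod G) (bd2 (postnikov K n))"
  by (rule xmod_hom_cong[OF _ xmod_hom_over_del])
    (use assms bd2_postnikov_eq_del in \<open>auto simp: postnikov_term_xmod simp del: postnikov_sel\<close>)

text \<open>
  Composites of boundaries and the action of \<open>Im \<partial>\<^sub>2\<close> are computed on representatives of cosets. For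
  \<open>\<partial>\<^sub>2 \<partial>\<^sub>3\<close>, which is \<open>\<delta>\<close> of dimension 3, triviality comes from \<open>del_postnikov_term_trivial\<close>.
\<close>
lemma crossed_complex_postnikov:
  assumes n: "2 \<le> n"
  shows "crossed_complex (postnikov K n)"
proof -
  let ?T = "postnikov_term K n"
  have bd_closed': "bd (postnikov K n) m x X \<in> carrier (grp (?T (m - 1)) x)"
    if "3 \<le> m" "x \<in> Obj G" "X \<in> carrier (grp (?T m) x)" for m x X
    using xmod_hom_closed[OF bd_postnikov_hom[OF that(1)] that(2,3)] .
  have "bd2 (postnikov K n) x (bd (postnikov K n) 3 x X) = Idn G x"
    if x: "x \<in> Obj G" and X: "X \<in> carrier (grp (?T 3) x)" for x X
  proof -
    have "bd2 (postnikov K n) x (bd (postnikov K n) 3 x X) = del (?T 2) x (bd (postnikov K n) 3 x X)"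
      using bd2_postnikov_eq_del[OF n x] bd_closed'[OF order_refl x X] by simp
    also have "\<dots> = del (?T 3) x X"
      using bd_postnikov_hom[OF order_refl] x X by (simp add: xmod_hom_def)
    finally show ?thesis using del_postnikov_term_trivial[OF order_refl x X] by simp
  qed
  moreover have "bd (postnikov K n) m x (bd (postnikov K n) (m + 1) x X) = \<one>\<^bsub>grp (?T (m - 1)) x\<^esub>"
    if m: "3 \<le> m" and x: "x \<in> Obj G" and X: "X \<in> carrier (grp (?T (m + 1)) x)" for m x X
  proof -
    consider "m + 1 \<le> n" | "m = n" | "n < m" by linarith
    then show ?thesis
    proof cases
      case 1
      obtain u where u: "u \<in> carrier (cgrp K (m + 1) x)" "X = trunc_im n (m + 1) x #>\<^bsub>cgrp K (m + 1) x\<^esub> u"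
        using cosetE[of "m + 1" n X x] 1 m X by auto
      have "bd K (m + 1) x ` X = {bd K (m + 1) x u}"
        using bd_coset[of "m + 1" n x u] 1 m x u by simp
      moreover have "m - 1 < n" using 1 by simp
      ultimately show ?thesis
        using bd_bd[OF m x u(1)] 1 m by (simp add: one_postnikov_term trunc_im_def)
    next
      \<comment> \<open>The boundary that leaves dimension \<open>n + 1\<close> takes the value \<open>Im \<partial>\<^sub>n\<^sub>+\<^sub>1\<close>, the unit coset.\<close>
      case 2
      have "trunc_im n n x = trunc_im n n x #>\<^bsub>cgrp K n x\<^esub> \<one>\<^bsub>cgrp K n x\<^esub>"
        using xmod_quotient.cls_eq_N_iff[OF term_quotient[of n n] x, of "\<one>\<^bsub>cgrp K n x\<^esub>"] n x
          group.is_monoid[OF term_group[of n x]]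
          subgroup.one_closed[OF xmod_quotient.N_subgroup[OF term_quotient[of n n]]]
        by (simp add: monoid.one_closed)
      then have "bd K n x ` trunc_im n n x = {\<one>\<^bsub>cgrp K (n - 1) x\<^esub>}"
        using bd_coset[of n n x "\<one>\<^bsub>cgrp K n x\<^esub>"] 2 m x group_hom.hom_one[OF bd_group_hom[of n x]]
          group.is_monoid[OF term_group[of n x]]
        by (simp add: monoid.one_closed)
      then show ?thesis
        using 2 m by (simp add: one_postnikov_term trunc_im_def)
    qed simp
  qed
  moreover have "act (?T m) (bd2 (postnikov K n) x W) X = X"
    if m: "3 \<le> m" and x: "x \<in> Obj G" and W: "W \<in> carrier (grp (?T 2) x)" and X: "X \<in> carrier (grp (?T m) x)"
    for m x W X
  proof (cases "m \<le> n")
    case True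
    obtain w where w: "w \<in> carrier (cgrp K 2 x)" "W = trunc_im n 2 x #>\<^bsub>cgrp K 2 x\<^esub> w"
      using cosetE[of 2 n W x] n W by auto
    obtain u where u: "u \<in> carrier (cgrp K m x)" "X = trunc_im n m x #>\<^bsub>cgrp K m x\<^esub> u"
      using cosetE[of m n X x] True m X by auto
    have "bd2 K x w \<in> Arr G \<and> Dom G (bd2 K x w) = x \<and> Cod G (bd2 K x w) = x"
      using xmodule.del_loop[OF term_xmodule[of 2] x w(1)] x w by (simp add: bd2_eq_del)
    then show ?thesis
      using act_postnikov_term[of m n "bd2 K x w" u] True m w u x n
      by (simp add: bd2_coset act_bd2)
  qed (use X in \<open>simp add: postnikov_term_above\<close>)
  ultimately show ?thesis
    unfolding crossed_complex_def postnikov_sel(1,2)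
    using groupoid postnikov_term_xmod bd2_postnikov_hom[OF n] bd_postnikov_hom
    by blast
qed

lemma n_crossed_complex_postnikov: "2 \<le> n \<Longrightarrow> n_crossed_complex n (postnikov K n)"
  by (simp add: n_crossed_complex_def crossed_complex_postnikov postnikov_term_above
      is_zero_xmod_zero groupoid)

section \<open>The fibrations of the tower\<close>

text \<open>
  On the level of cosets \<open>\<eta>\<close> is induced by the identity of \<open>C\<^sub>m\<close> in all dimensions up to \<open>n\<close>. This
  puts dimension \<open>n\<close>, where \<open>\<eta>\<close> is the quotient map, on the same footing as the lower ones.
\<close>
lemma eta_coset:
  assumes "2 \<le> m" "m \<le> n" "x \<in> Obj G" "u \<in> carrier (cgrp K m x)"
  shows "eta K (n + 1) m x (trunc_im (n + 1) m x #>\<^bsub>cgrp K m x\<^esub> u) = trunc_im n m x #>\<^bsub>cgrp K m x\<^esub> u"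
  using assms trunc_im_one_coset[of m n x u] trunc_im_one_coset[of m "n + 1" x u]
  by (auto simp: eta_def qmap_def trunc_im_def)

lemma eta_hom:
  assumes "2 \<le> m" "2 \<le> n"
  shows "xmod_hom_over G (postnikov_term K (n + 1) m) (postnikov_term K n m) (eta K (n + 1) m)"
proof -
  consider "m \<le> n" | "m = n + 1" | "n + 1 < m" by linarith
  then show ?thesis
  proof cases
    case 1
    then show ?thesis
      using assms quotient_xmod_hom[OF term_quotient[of m "n + 1"] term_quotient[of m n] id_xmod_hom]
      by (simp add: postnikov_term_quotient eta_coset[simplified] term_xmod)
  next
    case 2
    then have "eta K (n + 1) m = (\<lambda>x X. \<one>\<^bsub>grp (postnikov_term K n m) x\<^esub>)"
      by (simp add: eta_def postnikov_term_above)
    moreover have "xmod_hom_over G (postnikov_term K (n + 1) m) (postnikov_term K n m)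
        (\<lambda>x X. \<one>\<^bsub>grp (postnikov_term K n m) x\<^esub>)"
      by (rule xmod_hom_trivial)
        (use 2 assms del_postnikov_term_trivial in
          \<open>simp_all add: postnikov_term_xmod is_functor_id groupoid\<close>)
    ultimately show ?thesis by simp
  next
    case 3
    then show ?thesis
      using id_xmod_hom[OF crossed_module_zero[OF groupoid]] by (simp add: eta_def postnikov_term_above)
  qed
qed

text \<open>
  Up to dimension \<open>n\<close> both sides are the class of the boundary of a representative. In dimension \<open>n + 1\<close>
  that class is trivial since the boundary lies in \<open>Im \<partial>\<^sub>n\<^sub>+\<^sub>1\<close>, and above both sides are units.
\<close>
lemma eta_bd:
  assumes n: "2 \<le> n" and m: "3 \<le> m" and x: "x \<in> Obj G"
    and X: "X \<in> carrier (grp (postnikov_term K (n + 1) m) x)"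
  shows "eta K (n + 1) (m - 1) x (bd (postnikov K (n + 1)) m x X)
    = bd (postnikov K n) m x (eta K (n + 1) m x X)"
proof (cases "m \<le> n + 1")
  case True
  obtain u where u: "u \<in> carrier (cgrp K m x)" "X = trunc_im (n + 1) m x #>\<^bsub>cgrp K m x\<^esub> u"
    using cosetE[of m "n + 1" X x] True m X by auto
  have bdu: "bd K m x u \<in> carrier (cgrp K (m - 1) x)" using bd_closed[OF m x u(1)] .
  have "eta K (n + 1) (m - 1) x (bd (postnikov K (n + 1)) m x X)
      = eta K (n + 1) (m - 1) x (trunc_im (n + 1) (m - 1) x #>\<^bsub>cgrp K (m - 1) x\<^esub> bd K m x u)"
    using bd_coset[OF m True x u(1)] trunc_im_one_coset[of "m - 1" "n + 1" x, OF _ _ x bdu] True m u by simp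
  also have "\<dots> = trunc_im n (m - 1) x #>\<^bsub>cgrp K (m - 1) x\<^esub> bd K m x u"
    using True m x bdu by (intro eta_coset) auto
  also have "\<dots> = bd (postnikov K n) m x (eta K (n + 1) m x X)"
  proof (cases "m = n + 1")
    case True
    then have "trunc_im n n x #>\<^bsub>cgrp K n x\<^esub> bd K m x u = trunc_im n n x"
      using xmod_quotient.cls_eq_N_iff[OF term_quotient[of n n] x, of "bd K m x u"] n bdu u
      by (auto simp: trunc_im_def cim_def)
    then show ?thesis using True by (simp add: one_postnikov_term)
  next
    case False
    then have "m \<le> n" using True by simp
    then show ?thesis
      using bd_coset[OF m _ x u(1), of n] trunc_im_one_coset[of "m - 1" n x, OF _ _ x bdu] m u x eta_coset[of m n x u]
      by simp
  qed
  finally show ?thesis .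
next
  case False
  then consider "m = n + 2" | "n + 2 < m" by linarith
  then show ?thesis
    by cases (auto simp: eta_def postnikov_term_above)
qed

lemma bd2_eta:
  assumes n: "2 \<le> n" and x: "x \<in> Obj G" and X: "X \<in> carrier (grp (postnikov_term K (n + 1) 2) x)"
  shows "bd2 (postnikov K (n + 1)) x X = bd2 (postnikov K n) x (eta K (n + 1) 2 x X)"
proof -
  obtain u where u: "u \<in> carrier (cgrp K 2 x)" "X = trunc_im (n + 1) 2 x #>\<^bsub>cgrp K 2 x\<^esub> u"
    using cosetE[of 2 "n + 1" X x] n X by auto
  then show ?thesis
    using n x eta_coset[of 2 n x u] bd2_coset[of n x u] bd2_coset[of "n + 1" x u] by simp
qed

lemma eta_surj:
  assumes "2 \<le> m" "2 \<le> n" "x \<in> Obj G"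
  shows "eta K (n + 1) m x ` carrier (grp (postnikov_term K (n + 1) m) x) = carrier (grp (postnikov_term K n m) x)"
proof -
  consider "m \<le> n" | "m = n + 1" | "n + 1 < m" by linarith
  then show ?thesis
  proof cases
    case 1
    then show ?thesis
      using assms
      by (simp add: postnikov_term_quotient xmod_quotient.carrier_QM[OF term_quotient] image_image
          eta_coset[simplified])
  next
    case 2
    have "carrier (grp (postnikov_term K (n + 1) m) x) \<noteq> {}"
      using monoid.one_closed[OF group.is_monoid[OF xmodule.vertex_group[OF xmoduleI[OF postnikov_term_xmod]]]]
        assms by blast
    then show ?thesis
      using 2 by (auto simp: eta_def postnikov_term_above)
  qed (simp add: eta_def postnikov_term_above)
qed

lemma eta_fibration:
  assumes "2 \<le> n"
  shows "xcomplex_fibration (postnikov K (n + 1)) (postnikov K n) (\<lambda>x. x) (\<lambda>g. g) (eta K (n + 1))"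
  unfolding xcomplex_fibration_def xcomplex_hom_def postnikov_sel(1,2)
  using assms crossed_complex_postnikov[OF assms] crossed_complex_postnikov[of "n + 1"]
    is_functor_id[OF groupoid] eta_hom[OF _ assms] bd2_eta[OF assms] eta_bd[OF assms] eta_surj[OF _ assms]
  by auto

section \<open>Homotopy modules\<close>

lemma cker_iff:
  "u \<in> cker K n x \<longleftrightarrow> u \<in> carrier (cgrp K n x) \<and>
    (if n = 2 then bd2 K x u = Idn G x else bd K n x u = \<one>\<^bsub>cgrp K (n - 1) x\<^esub>)"
  by (auto simp: cker_def kernel_def End_simps)

lemma cker_carrier: "u \<in> cker K n x \<Longrightarrow> u \<in> carrier (cgrp K n x)"
  by (simp add: cker_iff)

lemma del_cker:
  assumes "2 \<le> n" "x \<in> Obj G" "u \<in> cker K n x"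
  shows "del (C n) x u = Idn G x"
proof (cases "n = 2")
  case True
  then show ?thesis using assms bd2_eq_del[of x u] by (simp add: cker_iff)
next
  case False
  then show ?thesis using assms cker_carrier by (intro del_trivial) auto
qed

lemma subgroup_cker:
  assumes "2 \<le> n" "x \<in> Obj G"
  shows "subgroup (cker K n x) (cgrp K n x)"
proof (cases "n = 2")
  case True
  have "group_hom (cgrp K 2 x) (grp (End_ggroup G) x) (bd2 K x)"
    using complex term_group[of 2 x] group_End assms(2)
    by (simp add: group_hom_def group_hom_axioms_def crossed_complex_def xmod_hom_def ggroup_hom_def
        one_xmod_def xm_def)
  then show ?thesis
    using True group_hom.subgroup_kernel by (simp add: cker_def)
next
  case False
  then show ?thesis
    using assms group_hom.subgroup_kernel[OF bd_group_hom[of n x]] by (simp add: cker_def)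
qed

lemma act_cker:
  assumes n: "2 \<le> n" and g: "g \<in> Arr G" and u: "u \<in> cker K n (Dom G g)"
  shows "act (C n) g u \<in> cker K n (Cod G g)"
proof -
  interpret M: xmodule G "C n" using n by (rule term_xmodule)
  have uC: "u \<in> carrier (cgrp K n (Dom G g))" using u by (rule cker_carrier)
  note act = M.act_closed[OF g uC]
  show ?thesis
  proof (cases "n = 2")
    case True
    then show ?thesis
      using g act M.del_act[OF g uC] del_cker[OF n Dom_Obj[OF g] u] by (simp add: cker_iff bd2_eq_del)
  next
    case False
    interpret M': xmodule G "C (n - 1)" using n False by (intro term_xmodule) simp
    have "bd K n (Cod G g) (act (C n) g u) = \<one>\<^bsub>cgrp K (n - 1) (Cod G g)\<^esub>"
      using bd_act[of n g u] u uC g n False group_hom.hom_one[OF M'.act_group_hom[OF g]]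
      by (simp add: cker_iff)
    then show ?thesis using n act False by (simp add: cker_iff)
  qed
qed

lemma cim_subset_cker:
  assumes "2 \<le> n" "x \<in> Obj G"
  shows "cim K n x \<subseteq> cker K n x"
proof
  fix u assume "u \<in> cim K n x"
  then obtain v where v: "v \<in> carrier (cgrp K (n + 1) x)" "u = bd K (n + 1) x v"
    by (auto simp: cim_def)
  then have "u \<in> carrier (cgrp K n x)" using bd_closed[of "n + 1" x v] assms by simp
  then show "u \<in> cker K n x"
    using v assms bd2_bd[of x v] bd_bd[of n x v] by (auto simp: cker_iff)
qed

abbreviation "cycles n \<equiv> sub_xmod (C n) (cker K n)"

text \<open>
  The cycles form a crossed module over \<open>G\<close>, and \<open>\<pi>\<^sub>n\<close> is its quotient by the boundaries. The groups
  \<open>\<pi>\<^sub>n(x)\<close> and the action of \<open>G\<close> on them come from this quotient.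
\<close>
lemma cycles_quotient:
  assumes n: "2 \<le> n"
  shows "xmod_quotient G (cycles n) (cim K n)"
proof -
  interpret M: xmod_quotient G "C n" "cim K n"
    using term_quotient[OF n order_refl] by (simp add: trunc_im_def[abs_def])
  have "xmodule G (cycles n)"
    by (intro xmoduleI M.crossed_module_sub subgroup_cker act_cker n)
  moreover have "subgroup (cim K n x) (grp (cycles n) x)" if "x \<in> Obj G" for x
    using group.subgroup_incl[OF M.vertex_group M.N_subgroup subgroup_cker cim_subset_cker] that n
    by (simp add: sub_xmod_def)
  ultimately show ?thesis
    by (intro xmod_quotient.intro xmod_quotient_axioms.intro)
      (simp_all add: sub_xmod_def M.N_stable M.N_killed)
qed

lemma grp_homotopy_module:
  "grp (homotopy_module K n) x = grp (quotient_xmod (cycles n) (cim K n)) x"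
  by (simp add: homotopy_module_def quotient_xmod_def sub_xmod_def)

lemma carrier_homotopy_module:
  "carrier (grp (homotopy_module K n) x) = (\<lambda>u. cim K n x #>\<^bsub>cgrp K n x\<^esub> u) ` cker K n x"
  by (auto simp: homotopy_module_def FactGroup_def RCOSETS_def r_coset_def)

lemma mult_homotopy_module:
  "X \<otimes>\<^bsub>grp (homotopy_module K n) x\<^esub> Y = X \<otimes>\<^bsub>grp (quotient_xmod (C n) (cim K n)) x\<^esub> Y"
  by (simp add: homotopy_module_def quotient_xmod_def FactGroup_def set_mult_def)

lemma comm_group_homotopy_module:
  assumes n: "2 \<le> n" and x: "x \<in> Obj G"
  shows "comm_group (grp (homotopy_module K n) x)"
proof -
  interpret M: xmodule G "C n" using n by (rule term_xmodule)
  interpret S: xmod_quotient G "cycles n" "cim K n" using n by (rule cycles_quotient)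
  have "u \<otimes>\<^bsub>cgrp K n x\<^esub> v = v \<otimes>\<^bsub>cgrp K n x\<^esub> u" if "u \<in> cker K n x" "v \<in> cker K n x" for u v
    using M.ker_del_central[OF x] del_cker[OF n x] cker_carrier that by blast
  then have "comm_group (grp (cycles n) x)"
    using S.vertex_group[OF x] by (intro group.group_comm_groupI) (auto simp: sub_xmod_def)
  then have "comm_group (grp (cycles n) x Mod cim K n x)"
    using comm_group.abelian_FactGroup S.N_subgroup[OF x] by blast
  then show ?thesis by (simp add: homotopy_module_def sub_xmod_def)
qed

text \<open>
  In dimension 2 the element \<open>\<partial>\<^sub>2 c\<close> acts as conjugation by \<open>c\<close>, and cycles are central; in higher
  dimensions this is part of the definition of a crossed complex.
\<close>
lemma act_im2_cker:
  assumes n: "2 \<le> n" and x: "x \<in> Obj G" and w: "w \<in> im2 K x" and u: "u \<in> cker K n x"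
  shows "act (C n) w u = u"
proof -
  obtain c where c: "c \<in> carrier (cgrp K 2 x)" "w = bd2 K x c"
    using w by (auto simp: im2_def)
  note uC = cker_carrier[OF u]
  show ?thesis
  proof (cases "n = 2")
    case False
    then show ?thesis using act_bd2[OF _ x c(1) uC] n c by simp
  next
    case [simp]: True
    interpret M: xmodule G "C 2" by (rule term_xmodule) simp
    interpret group "cgrp K 2 x" using x by (rule M.vertex_group)
    have "c \<otimes>\<^bsub>cgrp K 2 x\<^esub> u = u \<otimes>\<^bsub>cgrp K 2 x\<^esub> c"
      using M.ker_del_central[OF x, of u c] del_cker[OF n x u] uC c(1) by simp
    then show ?thesis
      using M.peiffer[OF x c(1), of u] uC c bd2_eq_del[OF x c(1)]
      by (metis True inv_solve_right' m_closed)
  qed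
qed

lemma im2_normal_subgroupoid:
  assumes "\<And>x. x \<in> Obj G \<Longrightarrow> N x = im2 K x"
  shows "normal_subgroupoid G N"
  using assms im2_eq by (intro xmodule.normal_subgroupoid_image[OF term_xmodule[of 2]]) auto

text \<open>
  An element of the class of \<open>g\<close> is \<open>g w\<close> with \<open>w \<in> Im \<partial>\<^sub>2\<close>, and \<open>w\<close> fixes every cycle. So letting the
  whole class act on a coset of cycles gives the same set as letting \<open>g\<close> act alone.
\<close>
lemma act_homotopy_module:
  assumes n: "2 \<le> n" and N: "\<And>x. x \<in> Obj G \<Longrightarrow> N x = im2 K x"
    and g: "g \<in> Arr G" and u: "u \<in> cker K n (Dom G g)"
  shows "act (homotopy_module K n) (gcoset G N g) (cim K n (Dom G g) #>\<^bsub>cgrp K n (Dom G g)\<^esub> u)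
    = act (C n) g ` (cim K n (Dom G g) #>\<^bsub>cgrp K n (Dom G g)\<^esub> u)" (is "_ = _ ` ?U")
proof -
  interpret N: normal_subgroupoid G N using N by (rule im2_normal_subgroupoid)
  interpret M: xmodule G "C n" using n by (rule term_xmodule)
  have U: "v \<in> cker K n (Dom G g)" if "v \<in> ?U" for v
    using that u cim_subset_cker[OF n, of "Dom G g"] g subgroup.m_closed[OF subgroup_cker[OF n, of "Dom G g"]]
    by (auto simp: r_coset_def)
  have "act (C n) (Comp G g w) v = act (C n) g v" if "w \<in> N (Dom G g)" "v \<in> ?U" for w v
  proof -
    have "w \<in> Arr G" "Dom G w = Dom G g" "Cod G w = Dom G g"
      using N.N_loop[OF Dom_Obj[OF g] that(1)] by blast+
    then have "act (C n) (Comp G g w) v = act (C n) g (act (C n) w v)"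
      using M.act_Comp[of g w v] cker_carrier[OF U[OF that(2)]] g by simp
    moreover have "act (C n) w v = v"
      by (rule act_im2_cker[OF n Dom_Obj[OF g] _ U[OF that(2)]]) (use N[OF Dom_Obj[OF g]] that(1) in simp)
    ultimately show ?thesis by simp
  qed
  then have "(\<lambda>(w, v). act (C n) (Comp G g w) v) ` (N (Dom G g) \<times> ?U)
      = (\<lambda>(w, v). act (C n) g v) ` (N (Dom G g) \<times> ?U)"
    by (intro image_cong) auto
  also have "\<dots> = act (C n) g ` snd ` (N (Dom G g) \<times> ?U)"
    by (simp only: image_image case_prod_unfold)
  also have "snd ` (N (Dom G g) \<times> ?U) = ?U"
    using N.Idn_N[OF Dom_Obj[OF g]] by auto
  also have "(\<lambda>(w, v). act (C n) (Comp G g w) v) ` (N (Dom G g) \<times> ?U)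
      = act (homotopy_module K n) (gcoset G N g) ?U"
    unfolding homotopy_module_def gcoset_def by auto
  finally show ?thesis by simp
qed

text \<open>
  Restricted to \<open>G\<close>, the module \<open>\<pi>\<^sub>n\<close> is the quotient of the crossed module of cycles.
\<close>
lemma homotopy_module_pullback:
  assumes n: "2 \<le> n" and N: "\<And>x. x \<in> Obj G \<Longrightarrow> N x = im2 K x"
  shows "is_ggroup G (pullback (\<lambda>x. x) (gcoset G N) (homotopy_module K n))"
proof -
  interpret S: xmod_quotient G "cycles n" "cim K n" using n by (rule cycles_quotient)
  have "is_ggroup G S.QM"
    using S.crossed_module_QM by (simp add: crossed_module_def)
  then show ?thesis
  proof (rule is_ggroup_cong[OF _ groupoid])
    fix g U assume g: "g \<in> Arr G" and "U \<in> carrier (grp S.QM (Dom G g))"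
    then obtain u where "u \<in> cker K n (Dom G g)" "U = cim K n (Dom G g) #>\<^bsub>cgrp K n (Dom G g)\<^esub> u"
      using carrier_homotopy_module[of n "Dom G g"] by (auto simp: grp_homotopy_module)
    then show "act (pullback (\<lambda>x. x) (gcoset G N) (homotopy_module K n)) g U = act S.QM g U"
      using act_homotopy_module[OF n N g] by (simp add: quotient_xmod_def sub_xmod_def)
  qed (simp add: grp_homotopy_module)
qed

lemma is_gmodule_homotopy_module:
  assumes n: "2 \<le> n" and N: "\<And>x. x \<in> Obj G \<Longrightarrow> N x = im2 K x"
  shows "is_gmodule (quotient_groupoid G N) (homotopy_module K n)"
proof -
  interpret N: normal_subgroupoid G N using N by (rule im2_normal_subgroupoid)
  have "is_ggroup N.Q (homotopy_module K n)"
    using is_ggroup_descend[OF groupoid homotopy_module_pullback[OF n N] N.is_functor_gcoset]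
    by (simp add: N.Q_simps)
  then show ?thesis
    using comm_group_homotopy_module[OF n] by (simp add: is_gmodule_def N.Q_simps)
qed

lemma homotopy_module_inclusion:
  assumes n: "2 \<le> n" and N: "\<And>x. x \<in> Obj G \<Longrightarrow> N x = im2 K x"
  shows "ggroup_hom G (pullback (\<lambda>x. x) (gcoset G N) (homotopy_module K n)) (postnikov_term K n n) (\<lambda>x U. U)"
proof -
  have T: "postnikov_term K n n = quotient_xmod (C n) (cim K n)"
    by (simp add: postnikov_term_def)
  interpret M: xmod_quotient G "C n" "cim K n"
    using term_quotient[OF n order_refl] by (simp add: trunc_im_def[abs_def])
  have "carrier (grp (homotopy_module K n) x) \<subseteq> carrier (grp M.QM x)" for x
    using cker_carrier by (auto simp: carrier_homotopy_module M.carrier_QM)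
  then have "(\<lambda>U. U) \<in> hom (grp (homotopy_module K n) x) (grp M.QM x)" for x
    by (auto simp: hom_def mult_homotopy_module)
  moreover have "act (homotopy_module K n) (gcoset G N g) U = act M.QM g U"
    if g: "g \<in> Arr G" and U: "U \<in> carrier (grp (homotopy_module K n) (Dom G g))" for g U
  proof -
    obtain u where "u \<in> cker K n (Dom G g)" "U = cim K n (Dom G g) #>\<^bsub>cgrp K n (Dom G g)\<^esub> u"
      using U carrier_homotopy_module by blast
    then show ?thesis using act_homotopy_module[OF n N g] by (simp add: quotient_xmod_def)
  qed
  ultimately show ?thesis
    unfolding T by (simp add: ggroup_hom_def)
qed

section \<open>2-extensions in dimensions at least two\<close>

text \<open>
  An element of \<open>C\<^sub>n\<close> appears in \<open>P\<^sub>n\<^sub>+\<^sub>1\<close> as a singleton. The class of \<open>u\<close> in dimension \<open>n + 1\<close> maps to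
  the singleton of its boundary, which is the unit exactly for cycles \<open>u\<close>; and the image consists of
  the singletons of elements of \<open>Im \<partial>\<^sub>n\<^sub>+\<^sub>1\<close>, which are those with trivial class.
\<close>
lemma postnikov_exact:
  assumes n: "2 \<le> n" and N: "\<And>x. x \<in> Obj G \<Longrightarrow> N x = im2 K x"
  shows "exact_ggroups G (pullback (\<lambda>x. x) (gcoset G N) (homotopy_module K (n + 1))) (\<lambda>x U. U)
    (postnikov_term K (n + 1) (n + 1)) (bd (postnikov K (n + 1)) (n + 1))
    (postnikov_term K (n + 1) n) (eta K (n + 1) n) (postnikov_term K n n)"
proof -
  let ?T = "postnikov_term K (n + 1)" and ?T' = "postnikov_term K n"
  define \<tau> where "\<tau> = eta K (n + 1) n"
  define \<sigma> where "\<sigma> = bd (postnikov K (n + 1)) (n + 1)"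
  have n1: "2 \<le> n + 1" "3 \<le> n + 1" using n by auto
  have gg: "is_ggroup G (postnikov_term K k m)" if "2 \<le> m" for k m
    using postnikov_term_xmod[OF that] by (simp add: crossed_module_def)
  have \<sigma>_hom: "ggroup_hom G (?T (n + 1)) (?T n) \<sigma>"
    using bd_postnikov_hom[OF n1(2), of "n + 1"] unfolding \<sigma>_def by (simp add: xmod_hom_def ggroup_hom_def)
  have \<tau>_hom: "ggroup_hom G (?T n) (?T' n) \<tau>"
    using eta_hom[OF n n] unfolding \<tau>_def by (simp add: xmod_hom_def ggroup_hom_def)
  have carrier1: "carrier (grp (?T (n + 1)) x)
      = (\<lambda>u. trunc_im (n + 1) (n + 1) x #>\<^bsub>cgrp K (n + 1) x\<^esub> u) ` carrier (cgrp K (n + 1) x)" for x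
    using xmod_quotient.carrier_QM[OF term_quotient[OF n1(1) order_refl]] by (simp add: postnikov_term_quotient)
  have carrier0: "carrier (grp (?T n) x) = (\<lambda>v. {v}) ` carrier (cgrp K n x)" if "x \<in> Obj G" for x
    using xmod_quotient.carrier_QM[OF term_quotient[of n "n + 1"], of x] n trunc_im_one_coset[of n "n + 1" x] that
    by (simp add: postnikov_term_quotient)
  have one0: "\<one>\<^bsub>grp (?T n) x\<^esub> = {\<one>\<^bsub>cgrp K n x\<^esub>}" for x
    by (simp add: one_postnikov_term trunc_im_def)
  have one': "\<one>\<^bsub>grp (?T' n) x\<^esub> = cim K n x" for x
    by (simp add: one_postnikov_term trunc_im_def)
  have image_filter: "{X \<in> f ` A. P X} = f ` {v \<in> A. P (f v)}" for f :: "'c \<Rightarrow> 'c set" and A P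
    by blast
  have \<sigma>_coset: "\<sigma> x (trunc_im (n + 1) (n + 1) x #>\<^bsub>cgrp K (n + 1) x\<^esub> u) = {bd K (n + 1) x u}"
    if "x \<in> Obj G" "u \<in> carrier (cgrp K (n + 1) x)" for x u
    using bd_coset[OF n1(2) order_refl that] by (simp add: \<sigma>_def)
  have \<tau>_singleton: "\<tau> x {v} = cim K n x #>\<^bsub>cgrp K n x\<^esub> v" for x v
    by (simp add: \<tau>_def eta_def qmap_def)
  have "carrier (grp (homotopy_module K (n + 1)) x) = kernel (grp (?T (n + 1)) x) (grp (?T n) x) (\<sigma> x)"
    if x: "x \<in> Obj G" for x
  proof -
    have "kernel (grp (?T (n + 1)) x) (grp (?T n) x) (\<sigma> x)
        = (\<lambda>u. trunc_im (n + 1) (n + 1) x #>\<^bsub>cgrp K (n + 1) x\<^esub> u) `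
          {u \<in> carrier (cgrp K (n + 1) x). bd K (n + 1) x u = \<one>\<^bsub>cgrp K n x\<^esub>}"
      unfolding kernel_def carrier1 one0 using \<sigma>_coset[OF x] by auto
    then show ?thesis
      using n by (simp add: carrier_homotopy_module cker_def kernel_def trunc_im_def)
  qed
  moreover have "\<sigma> x ` carrier (grp (?T (n + 1)) x) = kernel (grp (?T n) x) (grp (?T' n) x) (\<tau> x)"
    if x: "x \<in> Obj G" for x
  proof -
    have \<sigma>_image: "\<sigma> x ` carrier (grp (?T (n + 1)) x) = (\<lambda>v. {v}) ` cim K n x"
      unfolding carrier1 image_image cim_def using \<sigma>_coset[OF x] by (intro image_cong) auto
    have "cim K n x #>\<^bsub>cgrp K n x\<^esub> v = cim K n x \<longleftrightarrow> v \<in> cim K n x"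
      if "v \<in> carrier (cgrp K n x)" for v
      using xmod_quotient.cls_eq_N_iff[OF term_quotient[OF n order_refl] x that] by (simp add: trunc_im_def)
    moreover have "cim K n x \<subseteq> carrier (cgrp K n x)"
      using cim_subset_cker[OF n x] cker_carrier by blast
    ultimately have "{v \<in> carrier (cgrp K n x). cim K n x #>\<^bsub>cgrp K n x\<^esub> v = cim K n x} = cim K n x"
      by auto
    moreover have "kernel (grp (?T n) x) (grp (?T' n) x) (\<tau> x)
        = (\<lambda>v. {v}) ` {v \<in> carrier (cgrp K n x). cim K n x #>\<^bsub>cgrp K n x\<^esub> v = cim K n x}"
      by (simp only: kernel_def carrier0[OF x] one' image_filter \<tau>_singleton)
    ultimately show ?thesis
      unfolding \<sigma>_image by simp
  qed
  ultimately show ?thesis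
    unfolding exact_ggroups_def \<sigma>_def[symmetric] \<tau>_def[symmetric]
    using homotopy_module_pullback[OF n1(1) N] homotopy_module_inclusion[OF n1(1) N] gg n n1
      \<sigma>_hom \<tau>_hom eta_surj[OF n n, folded \<tau>_def]
    by simp
qed

end

text \<open>
  The complex built from a 2-extension has the same groups and actions as \<open>P\<^sub>n\<^sub>+\<^sub>1\<close>, but \<open>\<delta>\<close> and
  the boundaries are written as composites with \<open>\<eta>\<close>. They are compared on elements of the groups.
\<close>
lemma n_crossed_complex_cong:
  assumes K: "n_crossed_complex n K" and base: "base L = base K"
    and grp: "\<And>m. 2 \<le> m \<Longrightarrow> grp (cterm L m) = grp (cterm K m)"
    and act: "\<And>m. 2 \<le> m \<Longrightarrow> act (cterm L m) = act (cterm K m)"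
    and del: "\<And>m x u. \<lbrakk>2 \<le> m; x \<in> Obj (base K); u \<in> carrier (cgrp K m x)\<rbrakk>
      \<Longrightarrow> del (cterm L m) x u = del (cterm K m) x u"
    and bd2: "\<And>x u. \<lbrakk>x \<in> Obj (base K); u \<in> carrier (cgrp K 2 x)\<rbrakk> \<Longrightarrow> bd2 L x u = bd2 K x u"
    and bd: "\<And>m x u. \<lbrakk>3 \<le> m; x \<in> Obj (base K); u \<in> carrier (cgrp K m x)\<rbrakk> \<Longrightarrow> bd L m x u = bd K m x u"
  shows "n_crossed_complex n L"
proof -
  interpret K: xcomplex K
    using K by unfold_locales (simp add: n_crossed_complex_def)
  have cm: "crossed_module (base K) (cterm L m)" if "2 \<le> m" for m
    using crossed_module_cong[OF K.term_xmod[OF that] grp act del] that by blast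
  have "xmod_hom_over (base K) (cterm L 2) (one_xmod (base K)) (bd2 L)"
    by (rule xmod_hom_over_cong[where M = "cterm K 2" and M' = "one_xmod (base K)" and \<alpha> = "bd2 K"])
      (use K.complex K.term_xmod grp act del bd2 in \<open>simp_all add: crossed_complex_def\<close>)
  moreover have "xmod_hom_over (base K) (cterm L m) (cterm L (m - 1)) (bd L m)" if m: "3 \<le> m" for m
    using K.bd_hom[OF m] m
    by (rule_tac xmod_hom_over_cong[where M = "cterm K m" and M' = "cterm K (m - 1)" and \<alpha> = "bd K m"])
      (simp_all add: K.term_xmod grp act del bd)
  moreover have "bd2 L x (bd L 3 x u) = Idn (base K) x"
    if "x \<in> Obj (base K)" "u \<in> carrier (cgrp L 3 x)" for x u
    using that K.bd_closed[of 3 x u] K.bd2_bd by (simp add: grp bd bd2)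
  moreover have "bd L m x (bd L (m + 1) x u) = \<one>\<^bsub>cgrp L (m - 1) x\<^esub>"
    if "3 \<le> m" "x \<in> Obj (base K)" "u \<in> carrier (cgrp L (m + 1) x)" for m x u
    using that K.bd_closed[of "m + 1" x u] K.bd_bd[of m x u] by (simp add: grp bd)
  moreover have "act (cterm L m) (bd2 L x w) u = u"
    if "3 \<le> m" "x \<in> Obj (base K)" "w \<in> carrier (cgrp L 2 x)" "u \<in> carrier (cgrp L m x)" for m x w u
    using that K.act_bd2[of m x w u] by (simp add: grp act bd2)
  ultimately have "crossed_complex L"
    unfolding crossed_complex_def base using K.groupoid cm by blast
  then show ?thesis
    using K cm by (simp add: n_crossed_complex_def is_zero_xmod_def base grp)
qed

context xcomplex
begin

lemma im2_postnikov:
  assumes "2 \<le> n" "x \<in> Obj G"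
  shows "im2 (postnikov K n) x = im2 K x"
proof -
  have "carrier (grp (postnikov_term K n 2) x) = (\<lambda>u. trunc_im n 2 x #>\<^bsub>cgrp K 2 x\<^esub> u) ` carrier (cgrp K 2 x)"
    using xmod_quotient.carrier_QM[OF term_quotient[of 2 n]] assms by (simp add: postnikov_term_quotient)
  then show ?thesis
    using assms by (simp add: im2_def image_image bd2_coset)
qed

lemma xmod_image_postnikov:
  assumes "x \<in> Obj G"
  shows "xmod_image (postnikov_term K 2 2) x = im2 K x"
proof -
  have "xmod_image (postnikov_term K 2 2) x = im2 (postnikov K 2) x"
    unfolding xmod_image_def im2_def using bd2_postnikov_eq_del[OF order_refl assms]
    by (intro image_cong) auto
  then show ?thesis using im2_postnikov[OF order_refl assms] by simp
qed

text \<open>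
  Since \<open>\<eta>\<^sub>3\<close> is a morphism over \<open>G\<close>, composing the \<open>\<delta>\<close> of \<open>P\<^sub>2\<close> with it recovers the \<open>\<delta>\<close> of
  \<open>P\<^sub>3\<close>; so the complex of the extension agrees with \<open>P\<^sub>3\<close>.
\<close>
lemma two_extension_xmod_postnikov:
  "two_extension_xmod G (postnikov_term K 2 2) (homotopy_module K 3) (\<lambda>x U. U)
    (postnikov_term K 3 3) (bd (postnikov K 3) 3) (postnikov_term K 3 2) (eta K 3 2)"
proof -
  let ?M = "postnikov_term K 2 2"
  let ?L = "ext_xmod_complex G ?M (postnikov_term K 3 3) (bd (postnikov K 3) 3) (postnikov_term K 3 2) (eta K 3 2)"
  have del2: "del ?M x (eta K 3 2 x X) = del (postnikov_term K 3 2) x X"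
    if "x \<in> Obj G" "X \<in> carrier (grp (postnikov_term K 3 2) x)" for x X
    using eta_hom[of 2 2] that by (simp add: xmod_hom_def)
  have grp: "grp (cterm ?L m) = grp (postnikov_term K 3 m)"
    and act: "act (cterm ?L m) = act (postnikov_term K 3 m)" if "2 \<le> m" for m
    using that by (auto simp: ext_xmod_complex_def ext_xmod_term_def xm_def postnikov_term_above)
  have "n_crossed_complex 3 ?L"
  proof (rule n_crossed_complex_cong[where K = "postnikov K 3"], goal_cases)
    \<comment> \<open>agreement of \<open>\<delta>\<close>\<close>
    case (5 m x u)
    then show ?case
      using del2 del_postnikov_term_trivial[of 3 x u 3]
      by (auto simp: ext_xmod_complex_def ext_xmod_term_def xm_def postnikov_term_above)
  next
    \<comment> \<open>agreement of the boundary from dimension 2\<close>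
    case (6 x u)
    then show ?case
      using del2 bd2_postnikov_eq_del[of 3 x u] by (simp add: ext_xmod_complex_def)
  next
    \<comment> \<open>agreement of the higher boundaries\<close>
    case (7 m x u)
    then show ?case
      using grp[of "m - 1"] by (simp add: ext_xmod_complex_def)
  qed (simp_all add: grp act n_crossed_complex_postnikov, simp add: ext_xmod_complex_def)
  then show ?thesis
    unfolding two_extension_xmod_def xmod_pi1_def xmod_q1_def
    using postnikov_term_xmod[OF order_refl] postnikov_exact[of 2 "xmod_image ?M"] xmod_image_postnikov
      is_gmodule_homotopy_module[of 3 "xmod_image ?M"]
    by simp
qed

text \<open>
  The complex of the extension agrees with \<open>P\<^sub>n\<^sub>+\<^sub>1\<close>: below dimension \<open>n\<close> the terms of \<open>P\<^sub>n\<close> and \<open>P\<^sub>n\<^sub>+\<^sub>1\<close>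
  are equal, and in dimension \<open>n\<close> the boundary of \<open>P\<^sub>n\<close> composed with \<open>\<eta>\<close> is that of \<open>P\<^sub>n\<^sub>+\<^sub>1\<close>.
\<close>
lemma two_extension_xcomplex_postnikov:
  assumes n: "2 < n"
  shows "two_extension_xcomplex n (postnikov K n) (homotopy_module K (n + 1)) (\<lambda>x U. U)
    (postnikov_term K (n + 1) (n + 1)) (bd (postnikov K (n + 1)) (n + 1))
    (postnikov_term K (n + 1) n) (eta K (n + 1) n)"
proof -
  let ?P = "postnikov K (n + 1)"
  let ?L = "ext_xcomplex n (postnikov K n) (postnikov_term K (n + 1) (n + 1)) (bd ?P (n + 1))
    (postnikov_term K (n + 1) n) (eta K (n + 1) n)"
  have n': "2 \<le> n" using n by simp
  have low: "postnikov_term K n m = postnikov_term K (n + 1) m" if "m < n" for m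
    using that by (simp add: postnikov_term_def)
  have grp: "grp (cterm ?L m) = grp (postnikov_term K (n + 1) m)"
    and act: "act (cterm ?L m) = act (postnikov_term K (n + 1) m)" for m
    using low by (auto simp: ext_xcomplex_def ext_xcomplex_term_def xm_def postnikov_term_above)
  have "n_crossed_complex (n + 1) ?L"
  proof (rule n_crossed_complex_cong[where K = ?P], goal_cases)
    case (3 m)
    then show ?case using grp[of m] by simp
  next
    case (4 m)
    then show ?case using act[of m] by simp
  next
    \<comment> \<open>agreement of \<open>\<delta>\<close>\<close>
    case (5 m x u)
    then show ?case
      using n low del_postnikov_term_trivial[of m x u "n + 1"]
      by (auto simp: ext_xcomplex_def ext_xcomplex_term_def xm_def postnikov_term_above)
  next
    \<comment> \<open>agreement of the boundary from dimension 2\<close>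
    case (6 x u)
    then show ?case by (simp add: ext_xcomplex_def)
  next
    \<comment> \<open>agreement of the higher boundaries\<close>
    case (7 m x u)
    then have u: "x \<in> Obj G" "u \<in> carrier (grp (postnikov_term K (n + 1) m) x)" by simp_all
    consider "m < n" | "m = n" | "m = n + 1" | "n + 1 < m" by linarith
    then show ?case
    proof cases
      case 2
      have "eta K (n + 1) (n - 1) x (bd ?P n x u) = bd ?P n x u"
        using n by (auto simp: eta_def)
      then show ?thesis
        using eta_bd[OF n' _ u(1), of m u] 2 n u by (simp add: ext_xcomplex_def)
    next
      case 4
      then show ?thesis
        using grp[of "m - 1"] by (simp add: ext_xcomplex_def)
    qed (simp_all add: ext_xcomplex_def)
  qed (use n n_crossed_complex_postnikov[of "n + 1"] in \<open>simp_all add: ext_xcomplex_def\<close>)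
  then show ?thesis
    unfolding two_extension_xcomplex_def pi1_def q1_def
    using n n_crossed_complex_postnikov[OF n'] postnikov_exact[OF n', of "im2 (postnikov K n)"]
      im2_postnikov[OF n'] is_gmodule_homotopy_module[of "n + 1" "im2 (postnikov K n)"]
    by simp
qed

end

section \<open>The 2-extension of the fundamental groupoid\<close>

lemma crossed_complex_groupoid_xcomplex:
  assumes "is_groupoid G"
  shows "crossed_complex (groupoid_xcomplex G :: ('o, 'a, 'c) xcomplex)"
proof -
  interpret small_groupoid G by unfold_locales fact
  let ?Z = "zero_xmod G :: ('o, 'a, 'c) xmod"
  have Z: "crossed_module G ?Z" "is_functor G G (\<lambda>x. x) (\<lambda>g. g)"
    using assms by (simp_all add: crossed_module_zero is_functor_id)
  have "xmod_hom_over G ?Z ?Z (\<lambda>x u. \<one>\<^bsub>grp ?Z x\<^esub>)"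
    by (rule xmod_hom_trivial) (simp_all add: Z)
  moreover have "xmod_hom_over G ?Z (one_xmod G) (\<lambda>x u. Idn G x)"
    using xmod_hom_over_del[OF Z(1)]
    by (rule xmod_hom_cong[rotated]) (simp_all add: Z)
  ultimately show ?thesis
    using assms Z(1) by (simp add: crossed_complex_def groupoid_xcomplex_def)
qed

context xcomplex
begin

sublocale im2: normal_subgroupoid G "im2 K"
  by (rule im2_normal_subgroupoid) simp

lemma is_groupoid_pi1: "is_groupoid (pi1 K)"
  and is_functor_q1: "is_functor G (pi1 K) (\<lambda>x. x) (q1 K)"
  using im2.is_groupoid_Q im2.is_functor_gcoset by (simp_all add: pi1_def q1_def)

lemma Obj_pi1 [simp]: "Obj (pi1 K) = Obj G"
  by (simp add: pi1_def im2.Q_simps)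

lemma q1_surj: "q1 K ` Arr G = Arr (pi1 K)"
  by (simp add: pi1_def q1_def im2.Q_simps)

text \<open>
  Above the base the target is zero, so \<open>\<eta>\<^sub>2\<close> is trivial there. That this is a morphism means that
  \<open>q\<^sub>1 \<delta> = 1\<close>, which holds as \<open>\<delta>\<close> takes values in \<open>Im \<partial>\<^sub>2\<close>. Arrows of \<open>\<pi>\<^sub>1\<close> lift because \<open>q\<^sub>1\<close> is
  surjective and the identity on objects.
\<close>
lemma eta2_fibration:
  "xcomplex_fibration (postnikov K 2) (postnikov1 K) (\<lambda>x. x) (q1 K) (eta K 2)"
proof -
  let ?T = "postnikov_term K 2" and ?Z = "zero_xmod (pi1 K) :: ('o, 'a set, 'c set) xmod"
  have L [simp]: "base (postnikov1 K) = pi1 K" "cterm (postnikov1 K) m = ?Z"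
    "bd2 (postnikov1 K) x U = Idn (pi1 K) x" "bd (postnikov1 K) m x U = undefined" for m x U
    by (simp_all add: postnikov1_def groupoid_xcomplex_def)
  have eta: "eta K 2 m x X = undefined" if "2 \<le> m" "X \<in> carrier (grp (?T m) x)" for m x X
    using that by (cases "m = 2") (auto simp: eta_def postnikov_term_above)
  have q1_del: "q1 K (del (?T m) x X) = Idn (pi1 K) x"
    if m: "2 \<le> m" and x: "x \<in> Obj G" and X: "X \<in> carrier (grp (?T m) x)" for m x X
  proof -
    have "del (?T m) x X \<in> im2 K x"
    proof (cases "m = 2")
      case True
      then show ?thesis using X xmod_image_postnikov[OF x] by (auto simp: xmod_image_def)
    next
      case False
      then show ?thesis using del_postnikov_term_trivial[OF _ x X] m im2.Idn_N[OF x] by simp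
    qed
    then have "del (?T m) x X \<in> functor_kernel G (pi1 K) (q1 K)"
      using im2.functor_kernel_gcoset x by (auto simp: pi1_def q1_def)
    then obtain y where y: "y \<in> Obj G" "q1 K (del (?T m) x X) = Idn (pi1 K) y"
      by (auto simp: functor_kernel_def)
    have "del (?T m) x X \<in> Arr G \<and> Dom G (del (?T m) x X) = x"
      using xmodule.del_loop[OF xmoduleI[OF postnikov_term_xmod[OF m]] x X] by blast
    then have "Dom (pi1 K) (q1 K (del (?T m) x X)) = x"
      using is_functor_q1 by (simp add: is_functor_def)
    moreover have "Dom (pi1 K) (Idn (pi1 K) y) = y"
      using is_groupoid_pi1 y(1) by (simp add: is_groupoid_def)
    ultimately show ?thesis using y(2) by simp
  qed
  have "xmod_hom G (?T m) (pi1 K) ?Z (\<lambda>x. x) (q1 K) (eta K 2 m)" if m: "2 \<le> m" for m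
  proof (rule xmod_hom_cong)
    show "xmod_hom G (?T m) (pi1 K) ?Z (\<lambda>x. x) (q1 K) (\<lambda>x u. \<one>\<^bsub>grp ?Z x\<^esub>)"
      using m by (intro xmod_hom_trivial)
        (simp_all add: postnikov_term_xmod crossed_module_zero is_groupoid_pi1 is_functor_q1 q1_del)
  qed (use m eta in \<open>auto simp: postnikov_term_xmod\<close>)
  moreover have "q1 K (bd2 (postnikov K 2) x X) = bd2 (postnikov1 K) x (eta K 2 2 x X)"
    if "x \<in> Obj G" "X \<in> carrier (grp (?T 2) x)" for x X
    using bd2_postnikov_eq_del[OF order_refl that] q1_del[OF order_refl that] by simp
  moreover have "eta K 2 (m - 1) x (bd (postnikov K 2) m x X) = bd (postnikov1 K) m x (eta K 2 m x X)"
    if m: "3 \<le> m" and x: "x \<in> Obj G" and X: "X \<in> carrier (grp (?T m) x)" for m x X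
    using eta[of "m - 1"] xmod_hom_closed[OF bd_postnikov_hom[OF m] x X] m by simp
  moreover have "crossed_complex (postnikov1 K)"
    unfolding postnikov1_def by (rule crossed_complex_groupoid_xcomplex[OF is_groupoid_pi1])
  ultimately have "xcomplex_hom (postnikov K 2) (postnikov1 K) (\<lambda>x. x) (q1 K) (eta K 2)"
    unfolding xcomplex_hom_def postnikov_sel(1,2) L(1,2)
    using crossed_complex_postnikov[OF order_refl] is_functor_q1 by blast
  moreover have "\<exists>g\<in>Arr G. Dom G g = x \<and> q1 K g = h" if "h \<in> Arr (pi1 K)" "Dom (pi1 K) h = x" for h x
    using that is_functor_q1 by (auto simp: q1_surj[symmetric] is_functor_def)
  moreover have "eta K 2 m x ` carrier (grp (?T m) x) = carrier (grp ?Z x)" if "2 \<le> m" "x \<in> Obj G" for m x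
  proof -
    have "carrier (grp (?T m) x) \<noteq> {}"
      using monoid.one_closed[OF group.is_monoid[OF xmodule.vertex_group[OF xmoduleI[OF postnikov_term_xmod]]]]
        that by blast
    then show ?thesis using eta[OF that(1)] by (auto simp: image_iff)
  qed
  ultimately show ?thesis
    by (simp add: xcomplex_fibration_def)
qed

text \<open>
  The kernel of \<open>\<delta>\<close> on \<open>C\<^sub>2 / Im \<partial>\<^sub>3\<close> consists of the classes of 2-cycles, and its image is \<open>Im \<partial>\<^sub>2\<close>,
  the kernel of \<open>q\<^sub>1\<close>.
\<close>
lemma two_extension_groupoid_postnikov:
  "two_extension_groupoid (pi1 K) (homotopy_module K 2) (\<lambda>x U. U) G (postnikov_term K 2 2) (q1 K)"
proof -
  let ?A = "homotopy_module K 2" and ?T = "postnikov_term K 2 2"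
  interpret M: xmod_quotient G "C 2" "cim K 2"
    using term_quotient[of 2 2] by (simp add: trunc_im_def[abs_def])
  have T: "?T = M.QM" by (simp add: postnikov_term_def)
  interpret T: xmodule G M.QM by (intro xmoduleI M.crossed_module_QM)
  have one: "\<one>\<^bsub>grp ?A x\<^esub> = \<one>\<^bsub>grp M.QM x\<^esub>" for x
    by (simp add: homotopy_module_def quotient_xmod_def FactGroup_def)
  have sub: "carrier (grp ?A x) \<subseteq> carrier (grp M.QM x)" for x
    using cker_carrier by (auto simp: carrier_homotopy_module M.carrier_QM)
  have ker: "carrier (grp ?A x) = {X \<in> carrier (grp M.QM x). del M.QM x X = Idn G x}" if x: "x \<in> Obj G" for x
    using M.del_cls[OF x] bd2_eq_del[OF x]
    by (auto simp: carrier_homotopy_module M.carrier_QM cker_iff)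
  have hat_map: "hat_map (\<lambda>x U. U) = (\<lambda>p. p)"
    by (rule ext) (simp add: hat_map_def)
  have del_Idn_iff: "del M.QM x X \<in> Idn G ` Obj G \<longleftrightarrow> del M.QM x X = Idn G x"
    if "x \<in> Obj G" "X \<in> carrier (grp M.QM x)" for x X
    using T.del_loop[OF that] that(1) by force
  have "functor_kernel (hat (Obj G) M.QM) G (\<lambda>p. del M.QM (fst p) (snd p))
      = {p \<in> Arr (hat (Obj G) M.QM). del M.QM (fst p) (snd p) = Idn G (fst p)}"
    unfolding functor_kernel_def by (intro Collect_cong conj_cong refl del_Idn_iff) auto
  also have "\<dots> = Arr (hat (Obj G) ?A)"
    by (auto simp: ker)
  finally have functor_kernel_del:
    "Arr (hat (Obj G) ?A) = functor_kernel (hat (Obj G) M.QM) G (\<lambda>p. del M.QM (fst p) (snd p))" ..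
  have "(\<lambda>p. del M.QM (fst p) (snd p)) ` Arr (hat (Obj G) M.QM) = (\<Union>x\<in>Obj G. xmod_image M.QM x)"
    by (force simp: xmod_image_def)
  also have "\<dots> = functor_kernel G (pi1 K) (q1 K)"
    using xmod_image_postnikov by (simp add: T pi1_def q1_def im2.functor_kernel_gcoset)
  finally have image_del:
    "(\<lambda>p. del M.QM (fst p) (snd p)) ` Arr (hat (Obj G) M.QM) = functor_kernel G (pi1 K) (q1 K)" .
  have "is_functor (hat (Obj G) M.QM) G (\<lambda>x. x) (\<lambda>p. del M.QM (fst p) (snd p))"
    using T.del_loop T.del_mult group_hom.hom_one[OF T.del_group_hom]
    by (auto simp: is_functor_def End_simps)
  moreover have "is_functor (hat (Obj G) ?A) (hat (Obj G) M.QM) (\<lambda>x. x) (\<lambda>p. p)"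
    using sub by (auto simp: is_functor_def one mult_homotopy_module)
  moreover have "ggroup_hom G (pullback (\<lambda>x. x) (q1 K) ?A) M.QM (\<lambda>x U. U)"
    using homotopy_module_inclusion[of 2 "im2 K"] by (simp add: q1_def T)
  moreover have "is_gmodule (pi1 K) ?A"
    using is_gmodule_homotopy_module[of 2 "im2 K"] by (simp add: pi1_def)
  ultimately show ?thesis
    unfolding two_extension_groupoid_def hat_map T Obj_pi1 image_del functor_kernel_del[symmetric]
    using is_groupoid_pi1 M.crossed_module_QM is_functor_q1 q1_surj by simp
qed

end

theorem proposition4p5:
  fixes K :: "('o, 'a, 'c) xcomplex" and n :: nat
  assumes "crossed_complex K" and "n \<ge> 1"
  shows
    "(n = 1 \<longrightarrow>
        xcomplex_fibration (postnikov K 2) (postnikov1 K) (\<lambda>x. x) (q1 K) (eta K 2) \<and>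
        two_extension_groupoid (pi1 K) (homotopy_module K 2) (\<lambda>x U. U)
          (base (postnikov K 2)) (cterm (postnikov K 2) 2) (q1 K)) \<and>
     (n \<ge> 2 \<longrightarrow>
        xcomplex_fibration (postnikov K (n + 1)) (postnikov K n) (\<lambda>x. x) (\<lambda>g. g) (eta K (n + 1))) \<and>
     (n = 2 \<longrightarrow>
        two_extension_xmod (base (postnikov K 2)) (cterm (postnikov K 2) 2)
          (homotopy_module K 3) (\<lambda>x U. U)
          (cterm (postnikov K 3) 3) (bd (postnikov K 3) 3)
          (cterm (postnikov K 3) 2) (eta K 3 2)) \<and>
     (n > 2 \<longrightarrow>
        two_extension_xcomplex n (postnikov K n)
          (homotopy_module K (n + 1)) (\<lambda>x U. U)
          (cterm (postnikov K (n + 1)) (n + 1)) (bd (postnikov K (n + 1)) (n + 1))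
          (cterm (postnikov K (n + 1)) n) (eta K (n + 1) n))"
proof -
  interpret xcomplex K by unfold_locales fact
  show ?thesis
    unfolding postnikov_sel(1,2)
    by (intro conjI impI eta2_fibration two_extension_groupoid_postnikov eta_fibration
        two_extension_xmod_postnikov two_extension_xcomplex_postnikov)
qed

end
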